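(* Let $I\subset E(V)$ be a homogeneous ideal generated in degrees $\ge 2$, and let $J=\pi^{-1}(I)\subset K\langle X_1,\dots,X_n\rangle$. Let $G$ be a minimal Gröbner basis of $I$ with respect to $\prec_e$. Then the anti-commutators $\{X_iX_j+X_jX_i : 1\le j\le i\le n\}$, together with the set $$\{\delta(u\cdot f)\;:\; f\in G,\ u\in \mathcal{U}_{\mathrm{in}_{\prec_e}(I)}(\mathrm{in}_{\prec_e}(f))\},$$ constitute a minimal Gröbner basis for $J$ with respect to $\prec_t$. In particular, $\mathrm{in}_{\prec_t}(J)$ is minimally generated by $\{X_iX_j : 1\le j\le i\le n\}$ and $$\{\delta(u\cdot m)\;:\; m \text{ a minimal generator of } \mathrm{in}_{\prec_e}(I),\ u\in\mathcal{U}_{\mathrm{in}_{\prec_e}(I)}(m)\}.$$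
   Context: $K$ is an infinite field and $V$ a $K$-vector space of dimension $n$ with ordered basis $X_1,\dots,X_n$. The tensor algebra $T(V)$ is identified with the free associative algebra $K\langle X_1,\dots,X_n\rangle$, whose monomials are the words in the $X_i$. The exterior algebra $E(V)$ is the quotient of $K\langle X_1,\dots,X_n\rangle$ by the anti-commutator ideal $C$, the two-sided ideal generated by the anti-commutators $X_iX_j+X_jX_i$, $1\le i\le j\le n$ (for $i=j$ the anti-commutator is read as $X_i^2$, up to a scalar). $\pi:K\langle X_1,\dots,X_n\rangle\to E(V)$ is the quotient map and $x_i=\pi(X_i)$. $Y$ is the $K$-basis of $E(V)$ consisting of the square-free monomials $x_{i_1}\cdots x_{i_r}$, $i_1<\dots<i_r$; monomials of $E(V)$ are considered up to sign. For $m\in Y$ and $x_j\mid m$, $\frac{m}{x_j}$ is the element of $Y$ obtained by deleting $x_j$ from $m$. Orders: $\prec_s$ is a monoid well-order on the free abelian monoid on the variables, and $\prec_e$ is its restriction to $Y$; thus for $m,n,t\in Y$ with $mt\ne0$, $nt\ne 0$, $m\prec_e n$ implies $mt\prec_e nt$. Let $<_{lex}$ be the lexicographic order on words with $X_1<_{lex}X_2<_{lex}\cdots<_{lex}X_n$. The order $\prec_t$ on words (taken as a monoid well-order) is defined by: $M\prec_t N$ if (a) $\pi(M)\neq 0$, $\pi(N)\ne 0$ and $\pi(M)\prec_e\pi(N)$; or (b) $\pi(M)\neq 0$, $\pi(N)\ne 0$, $\pi(M)=\pi(N)$ (up to sign) and $M<_{lex}N$; or (c) at least one of $\pi(M),\pi(N)$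 is $0$ and $M<_{lex}N$. $\mathrm{in}$ of a non-zero element denotes its largest monomial, and $\mathrm{in}$ of an ideal denotes the monomial ideal generated by the initial monomials of its non-zero elements. A Gröbner basis of an ideal is a subset of it whose initial monomials generate the initial ideal; it is minimal if no proper subset of it is a Gröbner basis of the ideal. $\delta:E(V)\to T(V)$ is the $K$-linear section of $\pi$ with $\delta(x_{i_1}\cdots x_{i_r})=X_{i_1}\cdots X_{i_r}$ for $i_1<\dots<i_r$. For a monomial ideal $L\subset E(V)$ and a monomial $m=x_{i_1}\cdots x_{i_r}\in L$ with $i_1<\dots<i_r$, $$\mathcal{U}_L(m)=\{u \text{ a square-free monomial in } x_{i_1+1},\dots,x_{i_r-1} : u\tfrac{m}{x_{i_1}}\notin L,\ u\tfrac{m}{x_{i_r}}\notin L\},$$ where $u=1$ is allowed as a monomial.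
   Formalization: The full set need not be minimal, since different δ(uf) can share an initial monomial: it is shown a Gröbner basis, and minimal after keeping one per initial monomial. ≺_t as defined need not be a monoid well-order; it is (a)–(c) itself or any monoid well-order agreeing where π≠0. *)

theory Defs
  imports HOL.Hull "HOL-Library.Poly_Mapping" "HOL-Library.Multiset"
begin

section \<open>The free associative algebra\<close>

text \<open>
  The variables $X_1, \dots, X_n$ are indexed by a finite linearly ordered type \<open>'v\<close>.  Words are
  lists; with concatenation as (additively written) monoid operation, the convolution product of
  \<^typ>\<open>'v list \<Rightarrow>\<^sub>0 'k\<close> is the product of the free associative algebra.
\<close>

instantiation list :: (type) monoid_add
begin

definition zero_list :: "'a list" where "zero_list = []"

definition plus_list :: "'a list \<Rightarrow> 'a list \<Rightarrow> 'a list" where "plus_list xs ys = xs @ ys"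

instance
  by standard (simp_all add: zero_list_def plus_list_def)

end

type_synonym ('v, 'k) free_algebra = "'v list \<Rightarrow>\<^sub>0 'k"

definition word :: "'v list \<Rightarrow> ('v, 'k::field) free_algebra" where
  "word w = Poly_Mapping.single w 1"

definition var :: "'v \<Rightarrow> ('v, 'k::field) free_algebra" where
  "var i = word [i]"

section \<open>Two-sided ideals\<close>

definition is_ideal :: "'a::ring_1 set \<Rightarrow> bool" where
  "is_ideal I \<longleftrightarrow> 0 \<in> I \<and> (\<forall>a\<in>I. \<forall>b\<in>I. a + b \<in> I) \<and> (\<forall>a\<in>I. \<forall>r. r * a \<in> I \<and> a * r \<in> I)"

definition ideal_gen :: "'a::ring_1 set \<Rightarrow> 'a set" where
  "ideal_gen S = is_ideal hull S"

lemma is_ideal_Inter: "(\<And>I. I \<in> T \<Longrightarrow> is_ideal I) \<Longrightarrow> is_ideal (\<Inter>T)"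
  by (auto simp: is_ideal_def)

lemma is_ideal_ideal_gen: "is_ideal (ideal_gen S)"
  unfolding ideal_gen_def by (rule hull_in) (blast intro: is_ideal_Inter)

lemma is_ideal_diff:
  assumes "is_ideal I" "a \<in> I" "b \<in> I"
  shows "a - b \<in> I"
proof -
  have "- 1 * b \<in> I" using assms unfolding is_ideal_def by blast
  then have "a + - 1 * b \<in> I" using assms unfolding is_ideal_def by blast
  then show ?thesis by simp
qed

section \<open>The exterior algebra\<close>

text \<open>For \<open>i = j\<close> the factor 2 is dropped, so that the definition is right in characteristic 2.\<close>

definition anticommutator :: "'v \<Rightarrow> 'v \<Rightarrow> ('v, 'k::field) free_algebra" where
  "anticommutator i j = (if i = j then var i * var i else var i * var j + var j * var i)"

definition anticommutators :: "('v::linorder, 'k::field) free_algebra set" where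
  "anticommutators = {anticommutator i j | i j. j \<le> i}"

definition anticommutator_ideal :: "('v::linorder, 'k::field) free_algebra set" where
  "anticommutator_ideal = ideal_gen anticommutators"

lemma is_ideal_anticommutator_ideal: "is_ideal anticommutator_ideal"
  unfolding anticommutator_ideal_def by (rule is_ideal_ideal_gen)

quotient_type (overloaded) ('v, 'k) ext =
  "('v::linorder, 'k::field) free_algebra" / "\<lambda>a b. a - b \<in> anticommutator_ideal"
proof (rule equivpI)
  let ?C = "anticommutator_ideal :: ('v, 'k) free_algebra set"
  have C: "is_ideal ?C" by (rule is_ideal_anticommutator_ideal)
  show "reflp (\<lambda>a b. a - b \<in> ?C)"
    using C by (auto intro!: reflpI simp: is_ideal_def)
  show "symp (\<lambda>a b. a - b \<in> ?C)"
  proof (rule sympI)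
    fix a b assume "a - b \<in> ?C"
    then have "0 - (a - b) \<in> ?C" using C is_ideal_diff unfolding is_ideal_def by blast
    then show "b - a \<in> ?C" by simp
  qed
  show "transp (\<lambda>a b. a - b \<in> ?C)"
  proof (rule transpI)
    fix a b c assume "a - b \<in> ?C" "b - c \<in> ?C"
    then have "(a - b) + (b - c) \<in> ?C" using C unfolding is_ideal_def by blast
    then show "a - c \<in> ?C" by simp
  qed
qed

text \<open>\<^const>\<open>abs_ext\<close> is the quotient map $\pi$.\<close>

lemma lookup_mult_Nil:
  fixes f g :: "('v, 'k::field) free_algebra"
  shows "Poly_Mapping.lookup (f * g) [] = Poly_Mapping.lookup f [] * Poly_Mapping.lookup g []"
proof -
  let ?f = "Poly_Mapping.lookup f" and ?g = "Poly_Mapping.lookup g"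
  have inner: "(\<Sum>q. ?g q when [] = l + q) = (?g [] when l = [])" for l :: "'v list"
  proof -
    have "(?g q when [] = l + q) = ((?g [] when l = []) when q = [])" for q :: "'v list"
      by (auto simp: plus_list_def when_def)
    then show ?thesis by simp
  qed
  have "?f l * (?g [] when l = []) = (?f [] * ?g [] when l = [])" for l :: "'v list"
    by (auto simp: when_def)
  then show ?thesis by (simp add: times_poly_mapping.rep_eq prod_fun_def inner)
qed

lemma one_notin_anticommutator_ideal:
  "(1 :: ('v::linorder, 'k::field) free_algebra) \<notin> anticommutator_ideal"
proof -
  let ?N = "{f :: ('v, 'k) free_algebra. Poly_Mapping.lookup f [] = 0}"
  have "is_ideal ?N" by (simp add: is_ideal_def lookup_mult_Nil lookup_add)
  moreover have "anticommutators \<subseteq> ?N"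
    by (auto simp: anticommutators_def anticommutator_def var_def word_def lookup_add
        lookup_mult_Nil lookup_single)
  ultimately have "anticommutator_ideal \<subseteq> ?N"
    unfolding anticommutator_ideal_def ideal_gen_def by (intro hull_minimal)
  moreover have "(1 :: ('v, 'k) free_algebra) \<notin> ?N"
    by (simp add: lookup_one zero_list_def)
  ultimately show ?thesis by blast
qed

instantiation ext :: (linorder, field) ring_1
begin

lift_definition zero_ext :: "('a, 'b) ext" is 0 .

lift_definition one_ext :: "('a, 'b) ext" is 1 .

lift_definition plus_ext :: "('a, 'b) ext \<Rightarrow> ('a, 'b) ext \<Rightarrow> ('a, 'b) ext" is "(+)"
proof -
  fix a b c d :: "('a, 'b) free_algebra"
  assume "a - b \<in> anticommutator_ideal" "c - d \<in> anticommutator_ideal"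
  then have "(a - b) + (c - d) \<in> anticommutator_ideal"
    using is_ideal_anticommutator_ideal unfolding is_ideal_def by blast
  then show "(a + c) - (b + d) \<in> anticommutator_ideal" by (simp add: algebra_simps)
qed

lift_definition minus_ext :: "('a, 'b) ext \<Rightarrow> ('a, 'b) ext \<Rightarrow> ('a, 'b) ext" is "(-)"
proof -
  fix a b c d :: "('a, 'b) free_algebra"
  assume "a - b \<in> anticommutator_ideal" "c - d \<in> anticommutator_ideal"
  then have "(a - b) - (c - d) \<in> anticommutator_ideal"
    using is_ideal_diff[OF is_ideal_anticommutator_ideal] by blast
  then show "(a - c) - (b - d) \<in> anticommutator_ideal" by (simp add: algebra_simps)
qed

lift_definition uminus_ext :: "('a, 'b) ext \<Rightarrow> ('a, 'b) ext" is uminus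
proof -
  fix a b :: "('a, 'b) free_algebra"
  assume "a - b \<in> anticommutator_ideal"
  then have "- 1 * (a - b) \<in> anticommutator_ideal"
    using is_ideal_anticommutator_ideal unfolding is_ideal_def by blast
  then show "- a - - b \<in> anticommutator_ideal" by simp
qed

lift_definition times_ext :: "('a, 'b) ext \<Rightarrow> ('a, 'b) ext \<Rightarrow> ('a, 'b) ext" is "(*)"
proof -
  fix a b c d :: "('a, 'b) free_algebra"
  assume "a - b \<in> anticommutator_ideal" "c - d \<in> anticommutator_ideal"
  then have "(a - b) * c \<in> anticommutator_ideal" "b * (c - d) \<in> anticommutator_ideal"
    using is_ideal_anticommutator_ideal unfolding is_ideal_def by blast+
  then have "(a - b) * c + b * (c - d) \<in> anticommutator_ideal"
    using is_ideal_anticommutator_ideal unfolding is_ideal_def by blast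
  then show "a * c - b * d \<in> anticommutator_ideal" by (simp add: algebra_simps)
qed

instance
proof -
  have 0: "0 \<in> (anticommutator_ideal :: ('a, 'b) free_algebra set)"
    using is_ideal_anticommutator_ideal unfolding is_ideal_def by blast
  show "OFCLASS(('a, 'b) ext, ring_1_class)"
  proof (standard, goal_cases)
    case 11
    show ?case
    proof (transfer, rule notI)
      assume "0 - (1 :: ('a, 'b) free_algebra) \<in> anticommutator_ideal"
      then have "0 - (0 - (1 :: ('a, 'b) free_algebra)) \<in> anticommutator_ideal"
        using is_ideal_diff[OF is_ideal_anticommutator_ideal 0] by blast
      then have "(1 :: ('a, 'b) free_algebra) \<in> anticommutator_ideal" by simp
      then show False using one_notin_anticommutator_ideal by blast
    qed
  qed (transfer, simp add: algebra_simps 0)+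
qed

end

subsection \<open>The basis of square-free monomials\<close>

text \<open>
  A square-free monomial $x_{i_1} \cdots x_{i_r}$ with $i_1 < \dots < i_r$ is encoded by the set
  $\{i_1, \dots, i_r\}$.
\<close>

definition increasing_word :: "'v::linorder set \<Rightarrow> 'v list" where
  "increasing_word S = sorted_list_of_set S"

definition ext_monomial :: "'v::linorder set \<Rightarrow> ('v, 'k::field) ext" where
  "ext_monomial S = abs_ext (word (increasing_word S))"

definition ext_const :: "'k \<Rightarrow> ('v::linorder, 'k::field) ext" where
  "ext_const c = abs_ext (Poly_Mapping.single [] c)"

text \<open>Coordinates with respect to the $K$-basis of square-free monomials.\<close>

definition ext_coeff :: "('v::{finite,linorder}, 'k::field) ext \<Rightarrow> 'v set \<Rightarrow> 'k" where
  "ext_coeff e = (THE c. e = (\<Sum>S\<in>UNIV. ext_const (c S) * ext_monomial S))"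

definition ext_keys :: "('v::{finite,linorder}, 'k::field) ext \<Rightarrow> 'v set set" where
  "ext_keys e = {S. ext_coeff e S \<noteq> 0}"

definition delta :: "('v::{finite,linorder}, 'k::field) ext \<Rightarrow> ('v, 'k) free_algebra" where
  "delta e = (\<Sum>S\<in>UNIV. Poly_Mapping.single (increasing_word S) (ext_coeff e S))"

definition ext_homogeneous :: "nat \<Rightarrow> ('v::{finite,linorder}, 'k::field) ext \<Rightarrow> bool" where
  "ext_homogeneous d e \<longleftrightarrow> (\<forall>S\<in>ext_keys e. card S = d)"

section \<open>Monomial orders\<close>

text \<open>All orders are strict.  The free abelian monoid on the variables is \<^typ>\<open>'v multiset\<close>.\<close>

definition monoid_well_order :: "('m::monoid_add \<Rightarrow> 'm \<Rightarrow> bool) \<Rightarrow> bool" where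
  "monoid_well_order lt \<longleftrightarrow> irreflp lt \<and> transp lt \<and> totalp lt \<and> wfp lt \<and>
     (\<forall>a b c d. lt a b \<longrightarrow> lt (c + a + d) (c + b + d))"

definition order_e :: "('v multiset \<Rightarrow> 'v multiset \<Rightarrow> bool) \<Rightarrow> 'v set \<Rightarrow> 'v set \<Rightarrow> bool" where
  "order_e lt_s S T \<longleftrightarrow> lt_s (mset_set S) (mset_set T)"

definition up_to_sign :: "'a::uminus \<Rightarrow> 'a \<Rightarrow> bool" where
  "up_to_sign a b \<longleftrightarrow> a = b \<or> a = - b"

text \<open>
  The relation $\prec_t$ on words.  The first argument is a dummy: it fixes the field over which
  the exterior algebra is formed.
\<close>

definition order_t :: "'k::field itself \<Rightarrow> ('v::{finite,linorder} multiset \<Rightarrow> 'v multiset \<Rightarrow> bool) \<Rightarrow>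
    'v list \<Rightarrow> 'v list \<Rightarrow> bool" where
  "order_t K lt_s M N \<longleftrightarrow>
     (let pM = abs_ext (word M) :: ('v, 'k) ext; pN = abs_ext (word N) :: ('v, 'k) ext in
       (pM \<noteq> 0 \<and> pN \<noteq> 0 \<and>
         (\<exists>S T. up_to_sign pM (ext_monomial S) \<and> up_to_sign pN (ext_monomial T) \<and>
           order_e lt_s S T)) \<or>
       (pM \<noteq> 0 \<and> pN \<noteq> 0 \<and> up_to_sign pM pN \<and> ord_class.lexordp M N) \<or>
       ((pM = 0 \<or> pN = 0) \<and> ord_class.lexordp M N))"

text \<open>
  In general $\prec_t$ is not a total order on all words (clause (c) can destroy
  transitivity and compatibility with multiplication), although it is one on the words with
  non-zero image.  The following predicate holds for $\prec_t$ itself and for every monoid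
  well-order which coincides with it on the words with non-zero image.
\<close>

definition is_order_t :: "'k::field itself \<Rightarrow> ('v::{finite,linorder} multiset \<Rightarrow> 'v multiset \<Rightarrow> bool) \<Rightarrow>
    ('v list \<Rightarrow> 'v list \<Rightarrow> bool) \<Rightarrow> bool" where
  "is_order_t K lt_s lt \<longleftrightarrow> lt = order_t K lt_s \<or>
     (monoid_well_order lt \<and>
      (\<forall>M N. (abs_ext (word M) :: ('v, 'k) ext) \<noteq> 0 \<longrightarrow> (abs_ext (word N) :: ('v, 'k) ext) \<noteq> 0 \<longrightarrow>
        (lt M N \<longleftrightarrow> order_t K lt_s M N)))"

section \<open>Initial ideals and Groebner bases\<close>

text \<open>
  These notions are used both for the free algebra (\<open>mon = word\<close>, \<open>supp = Poly_Mapping.keys\<close>)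
  and for the exterior algebra (\<open>mon = ext_monomial\<close>, \<open>supp = ext_keys\<close>).  The element 0 has no
  initial monomial.
\<close>

definition is_initial :: "('a \<Rightarrow> 'm set) \<Rightarrow> ('m \<Rightarrow> 'm \<Rightarrow> bool) \<Rightarrow> 'a \<Rightarrow> 'm \<Rightarrow> bool" where
  "is_initial supp lt f m \<longleftrightarrow> m \<in> supp f \<and> (\<forall>m'\<in>supp f. m' \<noteq> m \<longrightarrow> lt m' m)"

definition initial :: "('a \<Rightarrow> 'm set) \<Rightarrow> ('m \<Rightarrow> 'm \<Rightarrow> bool) \<Rightarrow> 'a \<Rightarrow> 'm" where
  "initial supp lt f = (THE m. is_initial supp lt f m)"

definition initials :: "('a \<Rightarrow> 'm set) \<Rightarrow> ('m \<Rightarrow> 'm \<Rightarrow> bool) \<Rightarrow> 'a set \<Rightarrow> 'm set" where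
  "initials supp lt F = {m. \<exists>f\<in>F. is_initial supp lt f m}"

definition initial_ideal ::
  "('m \<Rightarrow> 'a::ring_1) \<Rightarrow> ('a \<Rightarrow> 'm set) \<Rightarrow> ('m \<Rightarrow> 'm \<Rightarrow> bool) \<Rightarrow> 'a set \<Rightarrow> 'a set" where
  "initial_ideal mon supp lt I = ideal_gen (mon ` initials supp lt I)"

definition groebner_basis ::
  "('m \<Rightarrow> 'a::ring_1) \<Rightarrow> ('a \<Rightarrow> 'm set) \<Rightarrow> ('m \<Rightarrow> 'm \<Rightarrow> bool) \<Rightarrow> 'a set \<Rightarrow> 'a set \<Rightarrow> bool" where
  "groebner_basis mon supp lt I G \<longleftrightarrow>
     G \<subseteq> I \<and> ideal_gen (mon ` initials supp lt G) = initial_ideal mon supp lt I"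

definition minimal_groebner_basis ::
  "('m \<Rightarrow> 'a::ring_1) \<Rightarrow> ('a \<Rightarrow> 'm set) \<Rightarrow> ('m \<Rightarrow> 'm \<Rightarrow> bool) \<Rightarrow> 'a set \<Rightarrow> 'a set \<Rightarrow> bool" where
  "minimal_groebner_basis mon supp lt I G \<longleftrightarrow>
     groebner_basis mon supp lt I G \<and> (\<forall>G'. G' \<subset> G \<longrightarrow> \<not> groebner_basis mon supp lt I G')"

definition minimally_generates :: "('m \<Rightarrow> 'a::ring_1) \<Rightarrow> 'm set \<Rightarrow> 'a set \<Rightarrow> bool" where
  "minimally_generates mon M L \<longleftrightarrow>
     ideal_gen (mon ` M) = L \<and> (\<forall>M'. M' \<subset> M \<longrightarrow> ideal_gen (mon ` M') \<noteq> L)"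

definition minimal_generators :: "('m \<Rightarrow> 'a::ring_1) \<Rightarrow> 'a set \<Rightarrow> 'm set" where
  "minimal_generators mon L = {m. \<exists>M. m \<in> M \<and> minimally_generates mon M L}"

text \<open>
  The set of all $\delta(u \cdot f)$ may contain different elements with the same initial monomial,
  and is then not minimal: for $I = (x_1x_2x_4 + x_1x_2x_5, x_1x_3x_4)$ with $x_5 \prec_e x_4$, both
  $\delta(x_3(x_1x_2x_4 + x_1x_2x_5))$ and $\delta(x_2x_1x_3x_4)$ occur, with initial monomial
  $X_1X_2X_3X_4$.  Minimality requires keeping one element for each initial monomial.
\<close>

definition one_per_initial ::
  "('a \<Rightarrow> 'm set) \<Rightarrow> ('m \<Rightarrow> 'm \<Rightarrow> bool) \<Rightarrow> 'a set \<Rightarrow> 'a set \<Rightarrow> bool" where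
  "one_per_initial supp lt B B' \<longleftrightarrow>
     B' \<subseteq> B \<and> bij_betw (initial supp lt) B' (initial supp lt ` B)"

section \<open>The sets $\mathcal{U}_L(m)$\<close>

definition U :: "('v::{finite,linorder}, 'k::field) ext set \<Rightarrow> 'v set \<Rightarrow> 'v set set" where
  "U L m = {u. u \<subseteq> {Min m<..<Max m} \<and>
     ext_monomial u * ext_monomial (m - {Min m}) \<notin> L \<and>
     ext_monomial u * ext_monomial (m - {Max m}) \<notin> L}"

end

theory Submission
  imports Defs
begin

text \<open>
  Every word is, in the exterior algebra, 0 or plus or minus the square-free monomial on its letters,
  and the increasing word is the lexicographically smallest one on a given set of letters.  Suppose
  that the initial word \<open>w\<close> of some $f \in J$ has no descent $X_iX_j$ with $j \le i$, so that it is
  increasing.  Another repetition-free word of $f$ on the same letters would be larger than \<open>w\<close>;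
  so there is none, the term of \<open>w\<close> does not cancel in $\pi(f) \in I$, and the letters of \<open>w\<close> form
  the initial monomial of $\pi(f)$ (\<open>initial_quotient\<close>).  Hence each initial word of $J$ either has a
  descent, and descents are the initial words of the anti-commutators, or is the increasing word of
  a monomial in $L = \mathrm{in}(I)$.

  It remains to find the minimal words of this kind in the order by factors.  A proper factor of an
  increasing word omits the first or the last letter.  So one deletes end letters as long as the
  monomial stays in $L$, and stops at a critical set $T$: one that belongs to $L$ but leaves it
  when its smallest or its largest element is removed (\<open>critical_factor\<close>).  A generator $m$ of $L$
  that divides a critical $T$ contains both ends of $T$, and $u = T \setminus m$ then satisfies exactly
  the conditions of $\mathcal{U}_L(m)$; so the critical sets are the $u \cup m$, for whatever
  generating family of $L$ the $m$ are taken from (\<open>critical_eq_U\<close>).  With $m$ the initial monomial of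
  $f \in G$, this word is the initial word of $\delta(u f)$ (\<open>initial_monomial_mult\<close>,
  \<open>initial_delta\<close>), which gives the Groebner basis; with $m$ a minimal generator it gives the second
  description.  Minimality holds since descents and critical words form an antichain for the order by
  factors (\<open>obstructions_antichain\<close>); generation in degrees $\ge 2$ enters here, as it keeps out
  words shorter than descents.

  All this rests on the coordinates of the exterior algebra.  The square-free monomials span it by
  sorting words (\<open>abs_ext_word\<close>).  They are independent since the signed count of the words on a given
  set of letters is multiplicative and vanishes on anti-commutators
  (\<open>normal_form_mult\<close>, \<open>anticommutator_ideal_normal_form\<close>).
\<close>

section \<open>Words, descents and signs\<close>

lemma increasing_word_props [simp]:
  "sorted_wrt (<) (increasing_word S)" "distinct (increasing_word S)"
  by (simp_all add: increasing_word_def)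

lemma set_increasing_word [simp]: "set (increasing_word (S :: 'v::{finite,linorder} set)) = S"
  by (simp add: increasing_word_def)

lemma length_increasing_word [simp]: "length (increasing_word S) = card S"
  by (simp add: increasing_word_def)

lemma increasing_word_eqI: "sorted_wrt (<) w \<Longrightarrow> w = increasing_word (set w)"
  unfolding increasing_word_def by (rule strict_sorted_equal) simp_all

definition descents :: "'v::linorder list set" where
  "descents = {[i, j] | i j. j \<le> i}"

text \<open>
  The descents are the initial words of the anti-commutators.  A word has none of them as a factor
  exactly if it is strictly increasing, so only the increasing words have to be studied further.
\<close>

lemma strictly_increasing_or_descent:
  obtains "sorted_wrt (<) w" | a d b where "w = a @ d @ b" "d \<in> descents"
proof (cases "sorted_wrt (<) w")
  case False
  have "\<not> successively (<) w \<Longrightarrow> \<exists>a i j b. w = a @ [i, j] @ b \<and> j \<le> i"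
  proof (induction w rule: induct_list012)
    case (3 x y zs)
    show ?case
    proof (cases "x < y")
      case True
      with 3 obtain a i j b where "y # zs = a @ [i, j] @ b" "j \<le> i" by auto
      then have "x # y # zs = (x # a) @ [i, j] @ b" by simp
      with \<open>j \<le> i\<close> show ?thesis by blast
    next
      case False
      then have "x # y # zs = [] @ [x, y] @ zs" "y \<le> x" by simp_all
      then show ?thesis by blast
    qed
  qed simp_all
  with False obtain a i j b where "w = a @ [i, j] @ b" "j \<le> i"
    by (auto simp: successively_conv_sorted_wrt)
  then show ?thesis by (intro that(2)[of a "[i, j]" b]) (auto simp: descents_def)
qed (rule that(1))

lemma increasing_word_descent_free:
  assumes "sorted_wrt (<) (a @ d @ b)" shows "d \<notin> descents"
  using assms by (auto simp: sorted_wrt_append descents_def)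

text \<open>
  \<open>crossing A B\<close> is the structure constant of the exterior algebra: the sign by which
  $x_A x_B$ differs from $x_{A \cup B}$, that is, the parity of the pairs which have to be
  interchanged, or 0 if a letter repeats.
\<close>

definition crossing :: "'v::linorder set \<Rightarrow> 'v set \<Rightarrow> 'k::field" where
  "crossing A B = (if A \<inter> B = {} then (- 1) ^ card {(x, y). x \<in> A \<and> y \<in> B \<and> y < x} else 0)"

text \<open>
  The sign of the permutation that sorts the word, extended by 0 to words with a repeated letter.
  The recursion through \<^term>\<open>crossing\<close> makes it multiplicative up to a factor that depends only on
  the letters of the two words.
\<close>

fun word_sign :: "'v::linorder list \<Rightarrow> 'k::field" where
  "word_sign [] = 1"
| "word_sign (x # xs) = crossing {x} (set xs) * word_sign xs"

lemma crossing_empty [simp]: "crossing {} B = 1" "crossing A {} = 1"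
  by (simp_all add: crossing_def)

lemma crossing_insert:
  assumes "finite A" "finite B" "x \<notin> A"
  shows "crossing (insert x A) B = crossing {x} B * (crossing A B :: 'k::field)"
proof -
  let ?P = "\<lambda>A. {(x, y). x \<in> A \<and> y \<in> B \<and> y < x}"
  have "?P (insert x A) = ?P {x} \<union> ?P A" "?P {x} \<inter> ?P A = {}" using assms by auto
  moreover have "finite (?P {x})" "finite (?P A)"
    by (rule finite_subset[of _ "(insert x A) \<times> B"]; use assms in auto)+
  ultimately have "card (?P (insert x A)) = card (?P {x}) + card (?P A)"
    by (simp add: card_Un_disjoint)
  then show ?thesis by (auto simp: crossing_def power_add)
qed

lemma crossing_union_right:
  assumes "finite B" "finite C" "B \<inter> C = {}"
  shows "crossing {x} (B \<union> C) = crossing {x} B * (crossing {x} C :: 'k::field)"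
proof -
  let ?P = "\<lambda>B. {(x', y). x' \<in> {x} \<and> y \<in> B \<and> y < x'}"
  have "?P (B \<union> C) = ?P B \<union> ?P C" "?P B \<inter> ?P C = {}" using assms by auto
  moreover have "finite (?P B)" "finite (?P C)"
    by (rule finite_subset[of _ "{x} \<times> (B \<union> C)"]; use assms in auto)+
  ultimately have "card (?P (B \<union> C)) = card (?P B) + card (?P C)"
    by (simp add: card_Un_disjoint)
  then show ?thesis by (auto simp: crossing_def power_add)
qed

lemma word_sign_eq_0_iff [simp]: "word_sign w = (0 :: 'k::field) \<longleftrightarrow> \<not> distinct w"
  by (induction w) (auto simp: crossing_def)

text \<open>
  The decisive property of the sign: the correction factor sees only the sets of letters.  Hence it
  gives the map to coordinates the multiplication of the exterior algebra, and signs of a word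
  can be compared factor by factor.
\<close>

lemma word_sign_append:
  "word_sign (v @ w) = word_sign v * word_sign w * (crossing (set v) (set w) :: 'k::field)"
proof (induction v)
  case (Cons x v)
  show ?case
  proof (cases "distinct (x # v @ w)")
    case True
    then show ?thesis
      using Cons crossing_union_right[of "set v" "set w" x, where 'k = 'k]
        crossing_insert[of "set v" "set w" x, where 'k = 'k] by simp
  next
    case False
    then have "word_sign ((x # v) @ w) = (0 :: 'k)" by (simp only: word_sign_eq_0_iff) simp
    moreover from False have "crossing (set (x # v)) (set w) = (0 :: 'k) \<or>
        \<not> distinct (x # v) \<or> \<not> distinct w"
      by (auto simp: crossing_def)
    then have "word_sign (x # v) * word_sign w * crossing (set (x # v)) (set w) = (0 :: 'k)"
      by (metis mult_eq_0_iff word_sign_eq_0_iff)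
    ultimately show ?thesis by (simp only:)
  qed
qed simp

lemma word_sign_increasing [simp]:
  assumes "sorted_wrt (<) w" shows "word_sign w = (1 :: 'k::field)"
  using assms
proof (induction w)
  case (Cons x w)
  then have "{(x', y). x' \<in> {x} \<and> y \<in> set w \<and> y < x'} = {}" "x \<notin> set w" by auto
  then have "crossing {x} (set w) = (1 :: 'k)" by (simp only: crossing_def) simp
  with Cons show ?case by simp
qed simp

lemma crossing_singletons: "crossing {i} {j} = (if i = j then 0 else if j < i then - 1 else 1)"
proof -
  have "{(x, y). x \<in> {i} \<and> y \<in> {j} \<and> y < x} = (if j < i then {(i, j)} else {})" by auto
  then show ?thesis unfolding crossing_def by simp
qed

lemma word_sign_swap:
  assumes "i \<noteq> j"
  shows "word_sign (a @ [i, j] @ b) = - (word_sign (a @ [j, i] @ b) :: 'k::field)"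
proof -
  have *: "word_sign [i, j] = - (word_sign [j, i] :: 'k)"
    using assms by (cases "i < j") (auto simp: crossing_singletons)
  have "set [i, j] = set [j, i]" by auto
  then show ?thesis unfolding word_sign_append set_append * by simp
qed

section \<open>Normal forms in the exterior algebra\<close>

text \<open>
  The coordinates of the image of a word in the exterior algebra.  They are defined without reference
  to the quotient, whose basis has yet to be established; \<open>normal_form\<close> extends them linearly.
\<close>

definition monomial_value :: "'v::linorder list \<Rightarrow> 'v set \<Rightarrow> 'k::field" where
  "monomial_value w S = (if set w = S then word_sign w else 0)"

definition normal_form :: "('v::linorder, 'k::field) free_algebra \<Rightarrow> 'v set \<Rightarrow> 'k" where
  "normal_form f S =
     (\<Sum>w\<in>Poly_Mapping.keys f. Poly_Mapping.lookup f w * monomial_value w S)"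

lemma normal_form_superset:
  assumes "finite W" "Poly_Mapping.keys f \<subseteq> W"
  shows "normal_form f S = (\<Sum>w\<in>W. Poly_Mapping.lookup f w * monomial_value w S)"
  unfolding normal_form_def
  by (rule sum.mono_neutral_left) (use assms in \<open>auto simp: in_keys_iff\<close>)

lemma normal_form_zero [simp]: "normal_form 0 S = 0"
  by (simp add: normal_form_def)

lemma normal_form_add: "normal_form (f + g) S = normal_form f S + normal_form g S"
proof -
  let ?W = "Poly_Mapping.keys f \<union> Poly_Mapping.keys g"
  have "Poly_Mapping.keys (f + g) \<subseteq> ?W" by (rule keys_add)
  then show ?thesis
    using normal_form_superset[of ?W f S] normal_form_superset[of ?W g S]
      normal_form_superset[of ?W "f + g" S]
    by (simp add: lookup_add distrib_right sum.distrib)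
qed

lemma normal_form_single [simp]: "normal_form (Poly_Mapping.single w c) S = c * monomial_value w S"
  by (simp add: normal_form_def)

lemma normal_form_sum: "normal_form (sum f A) S = (\<Sum>x\<in>A. normal_form (f x) S)"
  by (induction A rule: infinite_finite_induct) (simp_all add: normal_form_add)

lemma normal_form_diff: "normal_form (f - g) S = normal_form f S - normal_form g S"
  using normal_form_add[of "f - g" g S] by (simp add: algebra_simps)

lemma free_algebra_expand:
  "f = (\<Sum>w\<in>Poly_Mapping.keys f. Poly_Mapping.single w (Poly_Mapping.lookup f w))"
  by (rule poly_mapping_eqI) (auto simp: lookup_sum lookup_single when_def in_keys_iff)

lemma monomial_value_append:
  fixes v w :: "'v::{finite,linorder} list"
  shows "monomial_value (v @ w) S =
    (\<Sum>A\<in>UNIV. \<Sum>B\<in>UNIV. if A \<union> B = S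
       then crossing A B * monomial_value v A * (monomial_value w B :: 'k::field) else 0)"
proof -
  have "(\<Sum>A\<in>UNIV. \<Sum>B\<in>UNIV. if A \<union> B = S
       then crossing A B * monomial_value v A * (monomial_value w B :: 'k) else 0) =
     (\<Sum>A\<in>UNIV. \<Sum>B\<in>UNIV. if B = set w then if A = set v then
       monomial_value (v @ w) S else 0 else 0)"
    by (intro sum.cong refl) (auto simp: monomial_value_def word_sign_append)
  then show ?thesis by simp
qed

lemma sum_swap_inner:
  "(\<Sum>v\<in>K. \<Sum>w\<in>L. \<Sum>a\<in>M. h v w a) = (\<Sum>a\<in>M. \<Sum>v\<in>K. \<Sum>w\<in>L. h v w a)"
proof -
  have "(\<Sum>w\<in>L. \<Sum>a\<in>M. h v w a) = (\<Sum>a\<in>M. \<Sum>w\<in>L. h v w a)" for v by (rule sum.swap)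
  then show ?thesis by (simp only: sum.swap[of _ K M])
qed

text \<open>
  The right-hand side is the multiplication of the exterior algebra in coordinates, with structure
  constants \<^term>\<open>crossing\<close>.  It shows at once that the elements with vanishing normal form are an
  ideal, so that only the generators of the anti-commutator ideal have to be tested, and it
  later computes the support of a product.
\<close>

lemma normal_form_mult:
  fixes f g :: "('v::{finite,linorder}, 'k::field) free_algebra"
  shows "normal_form (f * g) S =
    (\<Sum>A\<in>UNIV. \<Sum>B\<in>UNIV. if A \<union> B = S
       then crossing A B * normal_form f A * normal_form g B else 0)"
proof -
  let ?K = "Poly_Mapping.keys f" and ?L = "Poly_Mapping.keys g"
  let ?a = "Poly_Mapping.lookup f" and ?b = "Poly_Mapping.lookup g"
  have "f * g = (\<Sum>v\<in>?K. \<Sum>w\<in>?L. Poly_Mapping.single (v @ w) (?a v * ?b w))"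
    by (subst free_algebra_expand[of f], subst free_algebra_expand[of g])
      (simp add: sum_product mult_single plus_list_def)
  then have "normal_form (f * g) S = (\<Sum>v\<in>?K. \<Sum>w\<in>?L. ?a v * ?b w * monomial_value (v @ w) S)"
    by (simp add: normal_form_sum)
  also have "\<dots> = (\<Sum>v\<in>?K. \<Sum>w\<in>?L. \<Sum>A\<in>UNIV. \<Sum>B\<in>UNIV. if A \<union> B = S
      then crossing A B * (?a v * monomial_value v A) * (?b w * monomial_value w B) else 0)"
    unfolding monomial_value_append sum_distrib_left
    by (intro sum.cong refl) (simp add: algebra_simps)
  also have "\<dots> = (\<Sum>A\<in>UNIV. \<Sum>B\<in>UNIV. \<Sum>v\<in>?K. \<Sum>w\<in>?L. if A \<union> B = S
      then crossing A B * (?a v * monomial_value v A) * (?b w * monomial_value w B) else 0)"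
    by (subst sum_swap_inner, rule sum.cong[OF refl], rule sum_swap_inner)
  also have "\<dots> = (\<Sum>A\<in>UNIV. \<Sum>B\<in>UNIV. if A \<union> B = S
       then crossing A B * normal_form f A * normal_form g B else 0)"
  proof (intro sum.cong refl)
    fix A B
    have "(\<Sum>v\<in>?K. \<Sum>w\<in>?L. crossing A B * (?a v * monomial_value v A) * (?b w * monomial_value w B))
        = crossing A B * ((\<Sum>v\<in>?K. ?a v * monomial_value v A) * (\<Sum>w\<in>?L. ?b w * monomial_value w B))"
      by (simp only: sum_product) (simp only: sum_distrib_left mult.assoc)
    then show "(\<Sum>v\<in>?K. \<Sum>w\<in>?L. if A \<union> B = S
        then crossing A B * (?a v * monomial_value v A) * (?b w * monomial_value w B) else 0)
      = (if A \<union> B = S then crossing A B * normal_form f A * normal_form g B else 0)"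
      by (simp add: normal_form_def mult.assoc)
  qed
  finally show ?thesis .
qed

text \<open>
  This is the linear independence of the square-free monomials: the normal form is well defined on the
  quotient.
\<close>

lemma anticommutator_ideal_normal_form:
  fixes f :: "('v::{finite,linorder}, 'k::field) free_algebra"
  assumes "f \<in> anticommutator_ideal"
  shows "normal_form f S = 0"
proof -
  let ?N = "{f :: ('v, 'k) free_algebra. \<forall>S. normal_form f S = 0}"
  have "is_ideal ?N"
    unfolding is_ideal_def
    by (auto simp: normal_form_add normal_form_mult intro!: sum.neutral)
  moreover have "normal_form (anticommutator i j :: ('v, 'k) free_algebra) S = 0" for i j S
    using word_sign_swap[of i j "[]" "[]", where 'k = 'k]
    by (cases "i = j") (auto simp: anticommutator_def var_def word_def mult_single
        plus_list_def normal_form_add monomial_value_def insert_commute[of i j]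
        simp del: word_sign.simps)
  then have "anticommutators \<subseteq> ?N" by (auto simp: anticommutators_def)
  ultimately have "anticommutator_ideal \<subseteq> ?N"
    unfolding anticommutator_ideal_def ideal_gen_def by (intro hull_minimal)
  with assms show ?thesis by blast
qed

section \<open>Coordinates in the exterior algebra\<close>

lemma abs_ext_add: "abs_ext (f + g) = abs_ext f + abs_ext g"
  by (simp add: plus_ext.abs_eq)

lemma abs_ext_mult: "abs_ext (f * g) = abs_ext f * abs_ext g"
  by (simp add: times_ext.abs_eq)

lemma abs_ext_zero: "abs_ext 0 = 0"
  by (simp add: zero_ext_def)

lemma abs_ext_sum: "abs_ext (sum f A) = (\<Sum>x\<in>A. abs_ext (f x))"
  by (induction A rule: infinite_finite_induct) (simp_all add: abs_ext_zero abs_ext_add)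

lemma abs_ext_surj: "\<exists>f. e = abs_ext f"
  by (induction e rule: ext.abs_induct) blast

lemma word_append: "word (v @ w) = word v * word w"
  by (simp add: word_def mult_single plus_list_def)

lemma abs_ext_single: "abs_ext (Poly_Mapping.single w c) = ext_const c * abs_ext (word w)"
  by (simp add: ext_const_def word_def abs_ext_mult[symmetric] mult_single plus_list_def)

lemma ext_const_0 [simp]: "ext_const 0 = 0"
  by (simp add: ext_const_def abs_ext_zero)

lemma ext_const_1 [simp]: "ext_const 1 = 1"
  by (simp add: ext_const_def one_ext_def one_poly_mapping.abs_eq single.abs_eq zero_list_def
      when_def eq_commute)

lemma ext_const_add: "ext_const (a + b) = ext_const a + ext_const b"
  by (simp add: ext_const_def single_add abs_ext_add)

lemma ext_const_mult: "ext_const (a * b) = ext_const a * ext_const b"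
  by (simp add: ext_const_def mult_single abs_ext_mult[symmetric] plus_list_def)

lemma ext_const_minus: "ext_const (- a) = - ext_const a"
  using ext_const_add[of a "- a"] by (simp add: eq_neg_iff_add_eq_0 add.commute)

lemma ext_const_sum: "ext_const (sum f A) = (\<Sum>x\<in>A. ext_const (f x))"
  by (induction A rule: infinite_finite_induct) (simp_all add: ext_const_add)

lemma abs_ext_repeated_letter: "abs_ext (word [i, i]) = 0"
proof -
  have "anticommutator i i \<in> anticommutator_ideal"
    unfolding anticommutator_ideal_def ideal_gen_def
    by (rule hull_inc) (auto simp: anticommutators_def)
  then have "abs_ext (anticommutator i i) = abs_ext 0" by (simp add: ext.abs_eq_iff)
  then show ?thesis
    by (simp add: abs_ext_zero anticommutator_def var_def word_append[symmetric])
qed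

lemma abs_ext_swap_letters:
  assumes "j < i" shows "abs_ext (word [i, j]) = - abs_ext (word [j, i])"
proof -
  have "anticommutator i j \<in> anticommutator_ideal"
    unfolding anticommutator_ideal_def ideal_gen_def
    by (rule hull_inc) (use assms in \<open>unfold anticommutators_def, blast intro: less_imp_le\<close>)
  then have "abs_ext (anticommutator i j) = abs_ext 0" by (simp add: ext.abs_eq_iff)
  moreover have "i \<noteq> j" using assms by simp
  ultimately show ?thesis
    by (simp add: abs_ext_zero anticommutator_def var_def word_append[symmetric] abs_ext_add
        eq_neg_iff_add_eq_0)
qed

text \<open>
  The spanning half of the basis theorem.  Interchanging the letters of a descent changes the sign and
  makes the word lexicographically smaller, while words of a given length over a finite alphabet
  admit no infinite lexicographic descent.
\<close>

lemma abs_ext_word: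
  fixes w :: "'v::{finite,linorder} list"
  shows "abs_ext (word w) = ext_const (word_sign w) * (ext_monomial (set w) :: ('v, 'k::field) ext)"
proof -
  let ?r = "{(x, y). x < (y :: 'v)}"
  have "wf (lenlex ?r)"
    by (intro wf_lenlex wf_finite_segments) (auto simp: irrefl_def trans_def)
  then show ?thesis
  proof (induction w rule: wf_induct_rule)
    case (less w)
    show ?case
    proof (cases w rule: strictly_increasing_or_descent)
      case 1
      then show ?thesis by (simp add: ext_monomial_def increasing_word_eqI[symmetric])
    next
      case (2 a d b)
      then obtain i j where w: "w = a @ [i, j] @ b" and ij: "j \<le> i" by (auto simp: descents_def)
      have split: "abs_ext (word (a @ c @ b)) =
          abs_ext (word a) * abs_ext (word c) * (abs_ext (word b) :: ('v, 'k) ext)" for c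
        by (simp add: word_append abs_ext_mult mult.assoc)
      show ?thesis
      proof (cases "i = j")
        case True
        then have "word_sign w = (0 :: 'k)" by (simp only: word_sign_eq_0_iff w) simp
        with True show ?thesis by (simp only: w split abs_ext_repeated_letter) simp
      next
        case False
        with ij have "j < i" by simp
        then have "(a @ [j, i] @ b, w) \<in> lenlex ?r"
          unfolding w lenlex_conv by (simp add: lex_append_leftI)
        then have "abs_ext (word (a @ [j, i] @ b)) =
            ext_const (word_sign (a @ [j, i] @ b)) * (ext_monomial (set w) :: ('v, 'k) ext)"
          using less.IH by (fastforce simp: w insert_commute)
        then show ?thesis
          using \<open>j < i\<close> unfolding w word_sign_swap[OF False] split
          by (simp only: abs_ext_swap_letters ext_const_minus) simp
      qed
    qed
  qed
qed

lemma normal_form_expansion: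
  fixes f :: "('v::{finite,linorder}, 'k::field) free_algebra"
  shows "abs_ext f = (\<Sum>S\<in>UNIV. ext_const (normal_form f S) * ext_monomial S)"
proof -
  let ?a = "Poly_Mapping.lookup f" and ?K = "Poly_Mapping.keys f"
  have "abs_ext f = (\<Sum>w\<in>?K. ext_const (?a w * word_sign w) * ext_monomial (set w))"
    by (subst free_algebra_expand[of f])
      (simp add: abs_ext_sum abs_ext_single abs_ext_word ext_const_mult mult.assoc)
  also have "\<dots> = (\<Sum>w\<in>?K. \<Sum>S\<in>UNIV. ext_const (?a w * monomial_value w S) * ext_monomial S)"
  proof (rule sum.cong[OF refl])
    fix w
    have "(\<Sum>S\<in>UNIV. ext_const (?a w * monomial_value w S) * ext_monomial S) =
        (\<Sum>S\<in>UNIV. if S = set w then ext_const (?a w * word_sign w) * ext_monomial (set w) else 0)"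
      by (rule sum.cong) (auto simp: monomial_value_def)
    then show "ext_const (?a w * word_sign w) * ext_monomial (set w) =
        (\<Sum>S\<in>UNIV. ext_const (?a w * monomial_value w S) * ext_monomial S)" by simp
  qed
  also have "\<dots> = (\<Sum>S\<in>UNIV. ext_const (normal_form f S) * ext_monomial S)"
    unfolding normal_form_def ext_const_sum sum_distrib_right by (rule sum.swap)
  finally show ?thesis .
qed

lemma monomial_value_increasing [simp]:
  fixes S :: "'v::{finite,linorder} set"
  shows "monomial_value (increasing_word S) T = (if S = T then 1 else 0)"
  by (simp add: monomial_value_def)

text \<open>
  Spanning and independence together: the description defining \<^term>\<open>ext_coeff\<close> has a
  unique solution, namely the normal form of any representative.
\<close>

lemma ext_coeff_abs: "ext_coeff (abs_ext f) = normal_form f"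
  unfolding ext_coeff_def
proof (rule the_equality)
  show "abs_ext f = (\<Sum>S\<in>UNIV. ext_const (normal_form f S) * ext_monomial S)"
    by (rule normal_form_expansion)
next
  fix c assume "abs_ext f = (\<Sum>S\<in>UNIV. ext_const (c S) * ext_monomial S)"
  also have "\<dots> = abs_ext (\<Sum>S\<in>UNIV. Poly_Mapping.single (increasing_word S) (c S))"
    by (simp add: abs_ext_sum abs_ext_single ext_monomial_def)
  finally have "f - (\<Sum>S\<in>UNIV. Poly_Mapping.single (increasing_word S) (c S))
      \<in> anticommutator_ideal"
    by (simp add: ext.abs_eq_iff)
  from anticommutator_ideal_normal_form[OF this]
  have "c S = normal_form f S" for S
    by (simp add: normal_form_diff normal_form_sum if_distrib cong: if_cong)
  then show "c = normal_form f" by auto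
qed

lemma ext_expansion: "e = (\<Sum>S\<in>UNIV. ext_const (ext_coeff e S) * ext_monomial S)"
proof -
  obtain f where "e = abs_ext f" using abs_ext_surj by blast
  then show ?thesis by (simp only: ext_coeff_abs normal_form_expansion[symmetric])
qed

lemma ext_coeff_zero [simp]: "ext_coeff 0 S = 0"
  by (simp add: abs_ext_zero[symmetric] ext_coeff_abs)

lemma ext_coeff_add: "ext_coeff (a + b) S = ext_coeff a S + ext_coeff b S"
proof -
  obtain f g where "a = abs_ext f" "b = abs_ext g" using abs_ext_surj by blast
  then show ?thesis by (simp only: abs_ext_add[symmetric] ext_coeff_abs normal_form_add)
qed

lemma ext_coeff_minus: "ext_coeff (- a) S = - ext_coeff a S"
  using ext_coeff_add[of "- a" a S] by (simp add: eq_neg_iff_add_eq_0)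

lemma ext_coeff_mult:
  "ext_coeff (a * b) S = (\<Sum>A\<in>UNIV. \<Sum>B\<in>UNIV. if A \<union> B = S
       then crossing A B * ext_coeff a A * ext_coeff b B else 0)"
proof -
  obtain f g where "a = abs_ext f" "b = abs_ext g" using abs_ext_surj by blast
  then show ?thesis by (simp only: abs_ext_mult[symmetric] ext_coeff_abs normal_form_mult)
qed

lemma ext_coeff_word: "ext_coeff (abs_ext (word w)) S = monomial_value w S"
  by (simp add: ext_coeff_abs word_def)

lemma ext_coeff_monomial: "ext_coeff (ext_monomial S) T = (if S = T then 1 else 0)"
  by (simp add: ext_monomial_def ext_coeff_word)

lemma ext_monomial_mult:
  fixes A B :: "'v::{finite,linorder} set"
  shows "ext_monomial A * ext_monomial B = ext_const (crossing A B) * ext_monomial (A \<union> B)"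
proof -
  have "ext_monomial A * ext_monomial B = abs_ext (word (increasing_word A @ increasing_word B))"
    by (simp add: ext_monomial_def word_append abs_ext_mult)
  then show ?thesis by (simp add: abs_ext_word word_sign_append)
qed

lemma ext_keys_mult:
  assumes "S \<in> ext_keys (a * b)"
  obtains A B where "A \<in> ext_keys a" "B \<in> ext_keys b" "S = A \<union> B"
proof -
  have "(\<Sum>A\<in>UNIV. \<Sum>B\<in>UNIV. if A \<union> B = S
       then crossing A B * ext_coeff a A * ext_coeff b B else 0) \<noteq> 0"
    using assms by (simp add: ext_keys_def ext_coeff_mult)
  then obtain A B where "(if A \<union> B = S
       then crossing A B * ext_coeff a A * ext_coeff b B else 0) \<noteq> 0"
    by (elim sum.not_neutral_contains_not_neutral)
  with that show ?thesis by (auto simp: ext_keys_def split: if_splits)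
qed

text \<open>
  Multiplication by a square-free monomial cannot cause cancellation, since $S$ arises only from
  $S \setminus u$, and with coefficient $\pm 1$.
\<close>

lemma ext_keys_monomial_mult:
  fixes f :: "('v::{finite,linorder}, 'k::field) ext"
  shows "S \<in> ext_keys (ext_monomial u * f) \<longleftrightarrow> u \<subseteq> S \<and> S - u \<in> ext_keys f"
proof -
  have "ext_coeff (ext_monomial u * f) S =
      (\<Sum>A\<in>UNIV. if A = u then \<Sum>B\<in>UNIV. if A \<union> B = S
        then crossing A B * ext_coeff f B else 0 else 0)"
    unfolding ext_coeff_mult ext_coeff_monomial
    by (rule sum.cong[OF refl]) (auto intro!: sum.cong sum.neutral split: if_splits)
  also have "\<dots> = (\<Sum>B\<in>UNIV. if u \<union> B = S then crossing u B * ext_coeff f B else 0)"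
    by simp
  also have "\<dots> = (\<Sum>B\<in>UNIV. if B = S - u then if u \<subseteq> S
      then crossing u (S - u) * ext_coeff f (S - u) else 0 else 0)"
  proof (rule sum.cong[OF refl])
    fix B
    have "u \<union> B = S \<longleftrightarrow> B = S - u \<and> u \<subseteq> S" if "u \<inter> B = {}" using that by blast
    moreover have "B \<noteq> S - u" and "crossing u B = (0 :: 'k)" if "u \<inter> B \<noteq> {}"
      using that by (auto simp: crossing_def)
    ultimately show "(if u \<union> B = S then crossing u B * ext_coeff f B else 0) = (if B = S - u
        then if u \<subseteq> S then crossing u (S - u) * ext_coeff f (S - u) else 0 else 0)"
      by (cases "u \<inter> B = {}") auto
  qed
  also have "\<dots> = (if u \<subseteq> S then crossing u (S - u) * ext_coeff f (S - u) else 0)"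
    by simp
  finally show ?thesis by (auto simp: ext_keys_def crossing_def)
qed

lemma abs_ext_delta: "abs_ext (delta e) = e"
  by (subst (2) ext_expansion) (simp add: delta_def abs_ext_sum abs_ext_single ext_monomial_def)

lemma increasing_word_inj [simp]:
  "increasing_word S = increasing_word T \<longleftrightarrow> S = (T :: 'v::{finite,linorder} set)"
  by (metis set_increasing_word)

lemma keys_delta: "Poly_Mapping.keys (delta e) = increasing_word ` ext_keys e"
proof -
  have "Poly_Mapping.lookup (delta e) w =
      (\<Sum>S\<in>UNIV. if increasing_word S = w then ext_coeff e S else 0)" for w
    unfolding delta_def lookup_sum by (rule sum.cong) (auto simp: lookup_single when_def)
  then have "w \<in> Poly_Mapping.keys (delta e) \<longleftrightarrow>
      (\<Sum>S\<in>UNIV. if increasing_word S = w then ext_coeff e S else 0) \<noteq> 0" for w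
    by (simp add: in_keys_iff)
  moreover have "(\<Sum>S\<in>UNIV. if increasing_word S = w then ext_coeff e S else 0) =
      (if w = increasing_word (set w) then ext_coeff e (set w) else 0)" for w
  proof -
    have "(\<Sum>S\<in>UNIV. if increasing_word S = w then ext_coeff e S else 0) =
      (\<Sum>S\<in>UNIV. if S = set w then
        if w = increasing_word (set w) then ext_coeff e (set w) else 0 else 0)"
      by (rule sum.cong) auto
    then show ?thesis by simp
  qed
  ultimately show ?thesis by (auto simp: ext_keys_def image_iff split: if_splits)
qed

section \<open>Monomial ideals\<close>

lemma ideal_gen_superset: "S \<subseteq> ideal_gen S"
  unfolding ideal_gen_def by (rule hull_subset)

lemma ideal_gen_least: "is_ideal I \<Longrightarrow> S \<subseteq> I \<Longrightarrow> ideal_gen S \<subseteq> I"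
  unfolding ideal_gen_def by (rule hull_minimal)

lemma ideal_gen_mono: "S \<subseteq> T \<Longrightarrow> ideal_gen S \<subseteq> ideal_gen T"
  unfolding ideal_gen_def by (rule hull_mono)

lemma ideal_mult_left: "is_ideal I \<Longrightarrow> a \<in> I \<Longrightarrow> r * a \<in> I"
  and ideal_mult_right: "is_ideal I \<Longrightarrow> a \<in> I \<Longrightarrow> a * r \<in> I"
  by (simp_all add: is_ideal_def)

text \<open>
  The tool that bounds ideals from above: membership in the ideal generated by monomials becomes a
  condition on each monomial of an element.
\<close>

lemma ext_keys_ideal:
  assumes "\<And>S T. P S \<Longrightarrow> S \<subseteq> T \<Longrightarrow> P T"
  shows "is_ideal {e :: ('v::{finite,linorder}, 'k::field) ext. \<forall>S\<in>ext_keys e. P S}"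
proof -
  let ?N = "{e :: ('v, 'k) ext. \<forall>S\<in>ext_keys e. P S}"
  have "0 \<in> ?N" by (simp add: ext_keys_def)
  moreover have "a + b \<in> ?N" if "a \<in> ?N" "b \<in> ?N" for a b
    using that by (fastforce simp: ext_keys_def ext_coeff_add)
  moreover have "r * a \<in> ?N \<and> a * r \<in> ?N" if "a \<in> ?N" for a r
    using that by (auto elim!: ext_keys_mult intro: assms[OF _ Un_upper1] assms[OF _ Un_upper2])
  ultimately show ?thesis unfolding is_ideal_def by blast
qed

lemma ext_const_mult_in_ideal_iff:
  assumes "is_ideal I" "c \<noteq> 0"
  shows "ext_const c * e \<in> I \<longleftrightarrow> e \<in> I"
proof
  assume "ext_const c * e \<in> I"
  then have "ext_const (1 / c) * (ext_const c * e) \<in> I" by (rule ideal_mult_left[OF assms(1)])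
  then show "e \<in> I" using assms(2) by (simp add: mult.assoc[symmetric] ext_const_mult[symmetric])
qed (rule ideal_mult_left[OF assms(1)])

text \<open>
  The disjunct for overlapping factors is what makes the sets $\mathcal{U}_L(m)$ consist of monomials
  prime to $m$: an overlap gives the product 0, which lies in $L$.
\<close>

lemma ext_monomial_mult_in_ideal_iff:
  fixes I :: "('v::{finite,linorder}, 'k::field) ext set"
  assumes "is_ideal I"
  shows "ext_monomial A * ext_monomial B \<in> I \<longleftrightarrow> A \<inter> B \<noteq> {} \<or> ext_monomial (A \<union> B) \<in> I"
proof (cases "A \<inter> B = {}")
  case True
  then show ?thesis unfolding ext_monomial_mult
    by (subst ext_const_mult_in_ideal_iff[OF assms]) (simp_all add: crossing_def)
next
  case False
  then show ?thesis using assms by (simp add: ext_monomial_mult crossing_def is_ideal_def)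
qed

lemma ext_monomial_in_ideal_gen_iff:
  "ext_monomial S \<in> (ideal_gen (ext_monomial ` M) :: ('v::{finite,linorder}, 'k::field) ext set) \<longleftrightarrow> (\<exists>m\<in>M. m \<subseteq> S)"
proof
  let ?P = "\<lambda>S. \<exists>m\<in>M. m \<subseteq> S"
  assume "ext_monomial S \<in> (ideal_gen (ext_monomial ` M) :: ('v, 'k) ext set)"
  moreover have "ideal_gen (ext_monomial ` M) \<subseteq> {e :: ('v, 'k) ext. \<forall>S\<in>ext_keys e. ?P S}"
    by (rule ideal_gen_least, rule ext_keys_ideal)
      (auto simp: ext_keys_def ext_coeff_monomial split: if_splits)
  ultimately show "?P S" by (force simp: ext_keys_def ext_coeff_monomial)
next
  assume "\<exists>m\<in>M. m \<subseteq> S"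
  then obtain m where m: "m \<in> M" "m \<subseteq> S" by blast
  let ?I = "ideal_gen (ext_monomial ` M) :: ('v, 'k) ext set"
  from m have "ext_monomial m \<in> ?I" using ideal_gen_superset by blast
  then have "ext_monomial m * ext_monomial (S - m) \<in> ?I"
    by (rule ideal_mult_right[OF is_ideal_ideal_gen])
  with m show "ext_monomial S \<in> ?I"
    by (subst (asm) ext_monomial_mult_in_ideal_iff[OF is_ideal_ideal_gen])
      (simp add: Un_absorb1)
qed

lemma word_keys_ideal:
  assumes "\<And>v w. P v \<or> P w \<Longrightarrow> P (v @ w)"
  shows "is_ideal {f :: ('v, 'k::field) free_algebra. \<forall>w\<in>Poly_Mapping.keys f. P w}"
proof -
  let ?N = "{f :: ('v, 'k) free_algebra. \<forall>w\<in>Poly_Mapping.keys f. P w}"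
  have add: "f + g \<in> ?N" if "f \<in> ?N" "g \<in> ?N" for f g
    using that keys_add[of f g] by blast
  have mult: "P w" if N: "f \<in> ?N \<or> g \<in> ?N" and w: "w \<in> Poly_Mapping.keys (f * g)" for f g w
  proof -
    obtain u v where "w = u @ v" "u \<in> Poly_Mapping.keys f" "v \<in> Poly_Mapping.keys g"
      using w keys_mult[of f g] unfolding plus_list_def by blast
    with N assms show ?thesis by blast
  qed
  have "0 \<in> ?N" by simp
  moreover have "r * f \<in> ?N \<and> f * r \<in> ?N" if "f \<in> ?N" for f r
    using mult[of r f] mult[of f r] that by blast
  ultimately show ?thesis unfolding is_ideal_def using add by blast
qed

lemma word_in_ideal_gen_iff:
  "word w \<in> (ideal_gen (word ` M) :: ('v, 'k::field) free_algebra set) \<longleftrightarrow>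
     (\<exists>a m b. m \<in> M \<and> w = a @ m @ b)"
proof
  let ?P = "\<lambda>w. \<exists>a m b. m \<in> M \<and> w = a @ m @ b"
  let ?N = "{f :: ('v, 'k) free_algebra. \<forall>w\<in>Poly_Mapping.keys f. ?P w}"
  have "is_ideal ?N"
  proof (rule word_keys_ideal)
    fix v w assume "?P v \<or> ?P w"
    then show "?P (v @ w)"
    proof
      assume "?P v"
      then obtain a m b where "m \<in> M" "v = a @ m @ b" by blast
      then have "v @ w = a @ m @ (b @ w)" by simp
      with \<open>m \<in> M\<close> show ?thesis by blast
    next
      assume "?P w"
      then obtain a m b where "m \<in> M" "w = a @ m @ b" by blast
      then have "v @ w = (v @ a) @ m @ b" by simp
      with \<open>m \<in> M\<close> show ?thesis by blast
    qed
  qed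
  moreover have "?P m" if "m \<in> M" for m
    using that append_Nil append_Nil2 by metis
  then have "word ` M \<subseteq> ?N" by (auto simp: word_def)
  ultimately have "ideal_gen (word ` M) \<subseteq> ?N" by (rule ideal_gen_least)
  moreover assume "word w \<in> (ideal_gen (word ` M) :: ('v, 'k) free_algebra set)"
  ultimately show "?P w" by (auto simp: word_def)
next
  assume "\<exists>a m b. m \<in> M \<and> w = a @ m @ b"
  then obtain a m b where m: "m \<in> M" and w: "w = a @ m @ b" by blast
  let ?I = "ideal_gen (word ` M) :: ('v, 'k) free_algebra set"
  from m have "word m \<in> ?I" using ideal_gen_superset by blast
  then have "word a * (word m * word b) \<in> ?I"
    by (intro ideal_mult_left ideal_mult_right is_ideal_ideal_gen)
  then show "word w \<in> ?I" by (simp add: w word_append)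
qed

section \<open>The orders\<close>

lemma order_e_properties:
  assumes "monoid_well_order lt_s"
  shows "\<not> order_e lt_s S S" "order_e lt_s S T \<Longrightarrow> \<not> order_e lt_s T S"
  using assms unfolding monoid_well_order_def order_e_def
  by (meson irreflpD transpD)+

lemma order_e_union:
  fixes S T u :: "'v::finite set"
  assumes "monoid_well_order lt_s" "order_e lt_s S T" "u \<inter> S = {}" "u \<inter> T = {}"
  shows "order_e lt_s (u \<union> S) (u \<union> T)"
proof -
  have "lt_s (mset_set u + mset_set S + {#}) (mset_set u + mset_set T + {#})"
    using assms(1,2) unfolding monoid_well_order_def order_e_def by blast
  then show ?thesis using assms(3,4) by (simp add: order_e_def mset_set_Union)
qed

lemma abs_ext_word_eq_0_iff:
  fixes w :: "'v::{finite,linorder} list"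
  shows "abs_ext (word w) = (0 :: ('v, 'k::field) ext) \<longleftrightarrow> \<not> distinct w"
proof
  assume "abs_ext (word w) = (0 :: ('v, 'k) ext)"
  then have "monomial_value w (set w) = (0 :: 'k)" by (metis ext_coeff_word ext_coeff_zero)
  then show "\<not> distinct w" by (simp add: monomial_value_def)
next
  assume "\<not> distinct w"
  then have "word_sign w = (0 :: 'k)" by simp
  then show "abs_ext (word w) = (0 :: ('v, 'k) ext)"
    by (simp only: abs_ext_word ext_const_0 mult_zero_left)
qed

lemma word_sign_cases: "distinct w \<Longrightarrow> word_sign w = (1 :: 'k::field) \<or> word_sign w = (- 1 :: 'k)"
  by (induction w) (auto simp: crossing_def minus_one_power_iff)

lemma up_to_sign_words:
  fixes v w :: "'v::{finite,linorder} list"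
  assumes "distinct v" "distinct w"
  shows "up_to_sign (abs_ext (word v)) (abs_ext (word w) :: ('v, 'k::field) ext) \<longleftrightarrow> set v = set w"
proof
  assume "up_to_sign (abs_ext (word v)) (abs_ext (word w) :: ('v, 'k) ext)"
  then have "ext_coeff (abs_ext (word v) :: ('v, 'k) ext) (set v) \<noteq> 0 \<Longrightarrow>
      ext_coeff (abs_ext (word w) :: ('v, 'k) ext) (set v) \<noteq> 0"
    by (auto simp: up_to_sign_def ext_coeff_minus)
  with assms show "set v = set w" by (auto simp: ext_coeff_word monomial_value_def split: if_splits)
next
  assume "set v = set w"
  with word_sign_cases[OF assms(1), where 'k = 'k] word_sign_cases[OF assms(2), where 'k = 'k]
  show "up_to_sign (abs_ext (word v)) (abs_ext (word w) :: ('v, 'k) ext)"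
    by (auto simp: up_to_sign_def abs_ext_word ext_const_minus)
qed

text \<open>
  On words with non-zero image, which are those without repeated letters, clauses (a) and (b) amount
  to comparing the sets of letters first and the words second.
\<close>

lemma order_t_distinct:
  fixes v w :: "'v::{finite,linorder} list"
  assumes "distinct v" "distinct w"
  shows "order_t TYPE('k::field) lt_s v w \<longleftrightarrow>
    order_e lt_s (set v) (set w) \<or> set v = set w \<and> ord_class.lexordp v w"
proof -
  have "up_to_sign (abs_ext (word v) :: ('v, 'k) ext) (ext_monomial S) \<longleftrightarrow> S = set v"
    if "distinct v" for v :: "'v list" and S
    using up_to_sign_words[of v "increasing_word S", where 'k = 'k] that
    by (auto simp: ext_monomial_def)
  with assms show ?thesis
    unfolding order_t_def Let_def
    by (simp add: abs_ext_word_eq_0_iff up_to_sign_words)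
qed

text \<open>
  All that is used of $\prec_t$ is this description on words without repeated letters and
  asymmetry, which makes initial words unique.  Both hold for the relation given by (a), (b), (c) and
  for each monoid well-order that extends its restriction to the words with non-zero image.
\<close>

lemma is_order_t_distinct:
  fixes v w :: "'v::{finite,linorder} list"
  assumes "is_order_t TYPE('k::field) lt_s lt" "distinct v" "distinct w"
  shows "lt v w \<longleftrightarrow> order_e lt_s (set v) (set w) \<or> set v = set w \<and> ord_class.lexordp v w"
  using assms order_t_distinct[OF assms(2,3), where 'k = 'k]
  by (auto simp: is_order_t_def abs_ext_word_eq_0_iff)

lemma lexordp_asym: "ord_class.lexordp v w \<Longrightarrow> \<not> ord_class.lexordp w (v :: 'v::linorder list)"
  using lexordp_antisym by blast

lemma is_order_t_asym:
  fixes v w :: "'v::{finite,linorder} list"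
  assumes "monoid_well_order lt_s" "is_order_t TYPE('k::field) lt_s lt" "lt v w"
  shows "\<not> lt w v"
  using assms(2) unfolding is_order_t_def
proof
  assume lt: "lt = order_t TYPE('k) lt_s"
  show ?thesis
  proof (cases "distinct v \<and> distinct w")
    case True
    with assms show ?thesis
      by (auto simp: is_order_t_distinct order_e_properties lexordp_asym)
  next
    case False
    with assms(3) show ?thesis
      unfolding lt order_t_def Let_def by (auto simp: abs_ext_word_eq_0_iff lexordp_asym)
  qed
next
  assume "monoid_well_order lt \<and> (\<forall>M N. (abs_ext (word M) :: ('v, 'k) ext) \<noteq> 0 \<longrightarrow>
      (abs_ext (word N) :: ('v, 'k) ext) \<noteq> 0 \<longrightarrow> lt M N = order_t TYPE('k) lt_s M N)"
  with assms(3) show ?thesis unfolding monoid_well_order_def by (meson irreflpD transpD)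
qed

text \<open>
  Every letter of the increasing word is at most the letters that follow it, so a rearrangement cannot
  have a smaller letter at the first place where they differ.
\<close>

lemma increasing_word_lexordp_least:
  fixes v w :: "'v::linorder list"
  assumes "distinct v" "sorted_wrt (<) w" "set v = set w"
  shows "\<not> ord_class.lexordp v w"
proof
  assume "ord_class.lexordp v w"
  moreover have "mset v = mset w"
    using assms strict_sorted_iff[of w] set_eq_iff_mset_eq_distinct[of v w] by simp
  ultimately show False
    using assms(2)
  proof (induction v w rule: lexordp_induct)
    case (Cons x xs y ys)
    then have "x \<in> set (y # ys)" by (metis list.set_intros(1) set_mset_mset)
    with Cons show ?case by auto
  qed auto
qed

lemma initial_eqI:
  assumes "\<And>a b. lt a b \<Longrightarrow> \<not> lt b a" "is_initial supp lt f m"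
  shows "initial supp lt f = m"
  unfolding initial_def
proof (rule the_equality)
  fix n assume "is_initial supp lt f n"
  with assms(2) have "n \<noteq> m \<Longrightarrow> lt n m \<and> lt m n" unfolding is_initial_def by metis
  with assms(1) show "n = m" by blast
qed (rule assms(2))

section \<open>Initial monomials under the quotient map\<close>

text \<open>
  The bridge from $J$ to $I$.  The increasing word is the smallest word on its letters; so if it is the
  initial word of $f$, no other word of $f$ has the same image up to sign, and its
  coefficient survives in $\pi(f)$.  The remaining words have image 0 or a smaller one.
\<close>

lemma initial_quotient:
  fixes f :: "('v::{finite,linorder}, 'k::field) free_algebra"
  assumes "monoid_well_order lt_s" "is_order_t TYPE('k) lt_s lt"
    and "is_initial Poly_Mapping.keys lt f w" "sorted_wrt (<) w"
  shows "is_initial ext_keys (order_e lt_s) (abs_ext f) (set w)"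
proof -
  have w: "distinct w" using assms(4) strict_sorted_iff by blast
  \<comment> \<open>Equal sets of letters would force \<open>v\<close> to precede the increasing word \<open>w\<close> lexicographically.\<close>
  have smaller: "order_e lt_s (set v) (set w)"
    if "v \<in> Poly_Mapping.keys f" "v \<noteq> w" "distinct v" for v
    using that assms(3) is_order_t_distinct[OF assms(2) that(3) w]
      increasing_word_lexordp_least[OF that(3) assms(4)]
    by (auto simp: is_initial_def)
  then have other: "set v \<noteq> set w" if "v \<in> Poly_Mapping.keys f" "v \<noteq> w" "distinct v" for v
    using that order_e_properties(1)[OF assms(1)] by metis
  have "normal_form f (set w) = (\<Sum>v\<in>Poly_Mapping.keys f. if v = w then Poly_Mapping.lookup f w else 0)"
    unfolding normal_form_def
  proof (rule sum.cong[OF refl])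
    fix v assume "v \<in> Poly_Mapping.keys f"
    then show "Poly_Mapping.lookup f v * monomial_value v (set w) =
        (if v = w then Poly_Mapping.lookup f w else 0)"
      using other[of v] assms(4) by (cases "distinct v") (auto simp: monomial_value_def)
  qed
  then have "set w \<in> ext_keys (abs_ext f)"
    using assms(3) by (simp add: ext_keys_def ext_coeff_abs is_initial_def in_keys_iff)
  moreover have "order_e lt_s S (set w)" if "S \<in> ext_keys (abs_ext f)" "S \<noteq> set w" for S
  proof -
    have "(\<Sum>v\<in>Poly_Mapping.keys f. Poly_Mapping.lookup f v * monomial_value v S) \<noteq> 0"
      using that(1) by (simp add: ext_keys_def ext_coeff_abs normal_form_def)
    then obtain v where "v \<in> Poly_Mapping.keys f" "monomial_value v S \<noteq> (0 :: 'k)"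
      by (auto elim: sum.not_neutral_contains_not_neutral)
    with smaller[of v] that(2) show ?thesis by (auto simp: monomial_value_def split: if_splits)
  qed
  ultimately show ?thesis by (simp add: is_initial_def)
qed

lemma initial_delta:
  assumes "is_order_t TYPE('k::field) lt_s lt"
    and "is_initial ext_keys (order_e lt_s) (e :: ('v::{finite,linorder}, 'k) ext) m"
  shows "is_initial Poly_Mapping.keys lt (delta e) (increasing_word m)"
  using assms(2) unfolding is_initial_def keys_delta
  by (auto simp: is_order_t_distinct[OF assms(1)])

text \<open>
  Disjointness is needed because the product of the initial monomial with $u$ could otherwise vanish.
\<close>

lemma initial_monomial_mult:
  assumes "monoid_well_order lt_s" "is_initial ext_keys (order_e lt_s) f m" "u \<inter> m = {}"
  shows "is_initial ext_keys (order_e lt_s) (ext_monomial u * f) (u \<union> m)"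
  unfolding is_initial_def ext_keys_monomial_mult
proof (intro conjI ballI impI)
  have "u \<union> m - u = m" using assms(3) by blast
  then show "u \<union> m - u \<in> ext_keys f" using assms(2) by (simp add: is_initial_def)
next
  fix T assume "T \<in> ext_keys (ext_monomial u * f)" "T \<noteq> u \<union> m"
  then have "u \<subseteq> T" "T - u \<in> ext_keys f" "T - u \<noteq> m" by (auto simp: ext_keys_monomial_mult)
  then have "order_e lt_s (u \<union> (T - u)) (u \<union> m)"
    using assms by (intro order_e_union) (auto simp: is_initial_def)
  with \<open>u \<subseteq> T\<close> show "order_e lt_s T (u \<union> m)" by (simp add: Un_absorb1)
qed auto

lemma initial_anticommutator:
  assumes "is_order_t TYPE('k::field) lt_s lt" "j \<le> (i :: 'v::{finite,linorder})"
  shows "is_initial Poly_Mapping.keys lt (anticommutator i j :: ('v, 'k) free_algebra) [i, j]"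
proof (cases "i = j")
  case True
  then show ?thesis
    by (simp add: is_initial_def anticommutator_def var_def word_append[symmetric]) (simp add: word_def)
next
  case False
  then have "w \<in> Poly_Mapping.keys (anticommutator i j :: ('v, 'k) free_algebra) \<longleftrightarrow>
      w \<in> {[i, j], [j, i]}" for w
    by (auto simp: in_keys_iff anticommutator_def var_def word_append[symmetric] lookup_add)
      (auto simp: word_def lookup_single when_def split: if_splits)
  moreover have "lt [j, i] [i, j]"
    using False assms by (auto simp: is_order_t_distinct[OF assms(1)])
  ultimately show ?thesis by (auto simp: is_initial_def)
qed

section \<open>Critical sets\<close>

text \<open>
  For an upward closed family $L$ without the empty set, these sets give the minimal increasing words
  on members of $L$ in the order by factors, since a proper factor of an increasing word omits its
  first or its last letter.
\<close>

definition critical :: "'v::linorder set set \<Rightarrow> 'v set set" where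
  "critical L = {T \<in> L. T - {Min T} \<notin> L \<and> T - {Max T} \<notin> L}"

lemma increasing_word_split_Min:
  assumes "T \<noteq> {}"
  shows "increasing_word T = [Min T] @ increasing_word (T - {Min (T :: 'v::{finite,linorder} set)})"
proof -
  have "sorted_wrt (<) ([Min T] @ increasing_word (T - {Min T}))"
    by (auto simp: less_le)
  then have "[Min T] @ increasing_word (T - {Min T}) =
      increasing_word (set ([Min T] @ increasing_word (T - {Min T})))"
    by (rule increasing_word_eqI)
  with assms show ?thesis by (simp add: insert_absorb)
qed

lemma increasing_word_split_Max:
  assumes "T \<noteq> {}"
  shows "increasing_word T = increasing_word (T - {Max T}) @ [Max (T :: 'v::{finite,linorder} set)]"
proof -
  have "sorted_wrt (<) (increasing_word (T - {Max T}) @ [Max T])"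
    by (auto simp: less_le sorted_wrt_append)
  then have "increasing_word (T - {Max T}) @ [Max T] =
      increasing_word (set (increasing_word (T - {Max T}) @ [Max T]))"
    by (rule increasing_word_eqI)
  with assms show ?thesis by (simp add: insert_absorb)
qed

text \<open>
  Delete end letters as long as the set stays in $L$; what remains is a contiguous piece of the word.
\<close>

lemma critical_factor:
  fixes T :: "'v::{finite,linorder} set"
  assumes "T \<in> L" "{} \<notin> L"
  shows "\<exists>a C b. C \<in> critical L \<and> increasing_word T = a @ increasing_word C @ b"
  using assms(1)
proof (induction "card T" arbitrary: T rule: less_induct)
  case less
  then have T: "T \<noteq> {}" using assms(2) by blast
  then have smaller: "card (T - {Min T}) < card T" "card (T - {Max T}) < card T"
    by (intro card_Diff1_less; simp)+
  consider "T - {Min T} \<in> L" | "T - {Max T} \<in> L" | "T \<in> critical L"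
    using less.prems by (auto simp: critical_def)
  then show ?case
  proof cases
    case 1
    from less.hyps[OF smaller(1) this] obtain a C b where
      "C \<in> critical L" "increasing_word (T - {Min T}) = a @ increasing_word C @ b" by blast
    then have "increasing_word T = (Min T # a) @ increasing_word C @ b"
      using increasing_word_split_Min[OF T] by simp
    with \<open>C \<in> critical L\<close> show ?thesis by blast
  next
    case 2
    from less.hyps[OF smaller(2) this] obtain a C b where
      "C \<in> critical L" "increasing_word (T - {Max T}) = a @ increasing_word C @ b" by blast
    then have "increasing_word T = a @ increasing_word C @ (b @ [Max T])"
      using increasing_word_split_Max[OF T] by simp
    with \<open>C \<in> critical L\<close> show ?thesis by blast
  next
    case 3
    have "increasing_word T = [] @ increasing_word T @ []" by simp
    with 3 show ?thesis by blast
  qed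
qed

lemma critical_factor_eq:
  fixes C T :: "'v::{finite,linorder} set"
  assumes up: "\<And>S T. S \<in> L \<Longrightarrow> S \<subseteq> T \<Longrightarrow> T \<in> L"
    and "C \<in> L" "T \<in> critical L" "increasing_word T = a @ increasing_word C @ b"
  shows "a = [] \<and> b = []"
proof (rule ccontr)
  assume "\<not> (a = [] \<and> b = [])"
  have T: "T = set a \<union> C \<union> set b" using assms(4) by (metis set_append set_increasing_word Un_assoc)
  have sorted: "sorted_wrt (<) (a @ increasing_word C @ b)"
    using increasing_word_props(1)[of T] assms(4) by simp
  \<comment> \<open>A letter before (after) the factor is smaller (larger) than all letters of \<open>C\<close>, so \<open>C\<close> misses
    the first (last) letter of \<open>T\<close>.\<close>
  from \<open>\<not> (a = [] \<and> b = [])\<close> have "C \<subseteq> T - {Min T} \<or> C \<subseteq> T - {Max T}"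
  proof (cases "a = []")
    case False
    then obtain x where x: "x \<in> set a" by (metis list.set_intros(1) list.exhaust)
    then have "Min T \<le> x" using T by simp
    moreover have "x < y" if "y \<in> C" for y using sorted x that by (auto simp: sorted_wrt_append)
    ultimately have "Min T \<notin> C" by force
    with T show ?thesis by blast
  next
    case True
    with \<open>\<not> (a = [] \<and> b = [])\<close> obtain x where x: "x \<in> set b"
      by (metis list.set_intros(1) list.exhaust)
    then have "x \<le> Max T" using T by simp
    moreover have "y < x" if "y \<in> C" for y using sorted x that by (auto simp: sorted_wrt_append)
    ultimately have "Max T \<notin> C" by force
    with T show ?thesis by blast
  qed
  with up[OF assms(2)] assms(3) show False by (auto simp: critical_def)
qed

text \<open>
  The minimal generators of the initial ideal of $J$ are described here by $L$ alone, so
  that different generating families of $L$ can be compared with the same set of words.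
\<close>

definition obstructions :: "'v::linorder set set \<Rightarrow> 'v list set" where
  "obstructions L = descents \<union> increasing_word ` critical L"

text \<open>
  Descents have length 2, so a proper factor of one is too short to be an obstruction; increasing words
  contain no descent; and a proper factor of a critical word omits an end letter, hence lies on
  letters outside $L$.
\<close>

lemma obstructions_antichain:
  fixes L :: "'v::{finite,linorder} set set"
  assumes up: "\<And>S T. S \<in> L \<Longrightarrow> S \<subseteq> T \<Longrightarrow> T \<in> L" and deg: "\<And>S. S \<in> L \<Longrightarrow> 2 \<le> card S"
    and v: "v \<in> obstructions L" and w: "w \<in> obstructions L" "w = a @ v @ b"
  shows "v = w"
proof -
  have len: "2 \<le> length v" "v \<in> descents \<or> (\<exists>C\<in>L. v = increasing_word C)"
    using v deg by (auto simp: obstructions_def descents_def critical_def)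
  consider "w \<in> descents" | T where "T \<in> critical L" "w = increasing_word T"
    using w(1) by (auto simp: obstructions_def)
  then show ?thesis
  proof cases
    case 1
    then have "length w = 2" by (auto simp: descents_def)
    with len(1) w(2) show ?thesis by (cases a; cases b) auto
  next
    case 2
    then have "sorted_wrt (<) (a @ v @ b)" using w(2) by (metis increasing_word_props(1))
    then have "v \<notin> descents" by (rule increasing_word_descent_free)
    with len(2) obtain C where "C \<in> L" "v = increasing_word C" by blast
    with 2 w(2) critical_factor_eq[of L C T a b] up show ?thesis by auto
  qed
qed

lemma obstruction_factor:
  fixes L :: "'v::{finite,linorder} set set"
  assumes "{} \<notin> L" "sorted_wrt (<) w \<Longrightarrow> set w \<in> L"
  shows "\<exists>a v b. v \<in> obstructions L \<and> w = a @ v @ b"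
proof (cases w rule: strictly_increasing_or_descent)
  case 1
  from critical_factor[OF assms(2)[OF 1] assms(1)] increasing_word_eqI[OF 1]
  show ?thesis by (auto simp: obstructions_def)
next
  case (2 a d b)
  then show ?thesis by (auto simp: obstructions_def)
qed

lemma U_disjoint:
  fixes L :: "('v::{finite,linorder}, 'k::field) ext set"
  assumes "is_ideal L" "m \<noteq> {}" "u \<in> U L m"
  shows "u \<inter> m = {}"
proof -
  have "u \<inter> (m - {Min m}) = {}"
    using assms(3) ext_monomial_mult_in_ideal_iff[OF assms(1)] unfolding U_def by blast
  moreover have "Min m \<notin> u" using assms(3) by (auto simp: U_def)
  ultimately show ?thesis by blast
qed

lemma Min_Max_between:
  fixes m u :: "'v::{finite,linorder} set"
  assumes "m \<noteq> {}" "u \<subseteq> {Min m<..<Max m}"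
  shows "Min (u \<union> m) = Min m" "Max (u \<union> m) = Max m"
proof -
  have "Min m \<in> m" "Max m \<in> m" using assms(1) by simp_all
  moreover have "Min m < x \<and> x < Max m" if "x \<in> u" for x using that assms(2) by auto
  ultimately show "Min (u \<union> m) = Min m" "Max (u \<union> m) = Max m"
    by (auto intro!: Min_eqI Max_eqI dest: less_imp_le simp del: Min_in Max_in)
qed

text \<open>
  Let $m \subseteq T$ with $m$ in a generating family and $T$ critical.  Deleting an end of $T$ leads
  out of $L$, so $m$ contains both ends, $u = T \setminus m$ lies strictly between them, and the two
  conditions defining $\mathcal{U}_L(m)$ say that $T$ without its first or last letter is not in $L$.
  The left-hand side does not mention the generating family; this is why the initial monomials
  of a Groebner basis and the minimal generators of the initial ideal lead to the same words.
\<close>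

lemma critical_eq_U:
  fixes inI :: "('v::{finite,linorder}, 'k::field) ext set" and M :: "'v set set"
  defines "L \<equiv> {S. ext_monomial S \<in> inI}"
  assumes inI: "inI = ideal_gen (ext_monomial ` M)" and deg: "\<And>S. S \<in> L \<Longrightarrow> 2 \<le> card S"
  shows "critical L = {u \<union> m | u m. m \<in> M \<and> u \<in> U inI m}"
proof -
  have ideal: "is_ideal inI" unfolding inI by (rule is_ideal_ideal_gen)
  have L: "S \<in> L \<longleftrightarrow> (\<exists>m\<in>M. m \<subseteq> S)" for S
    unfolding L_def inI by (simp add: ext_monomial_in_ideal_gen_iff)
  have U: "u \<in> U inI m \<longleftrightarrow> u \<subseteq> {Min m<..<Max m} \<and>
      u \<inter> (m - {Min m}) = {} \<and> u \<union> (m - {Min m}) \<notin> L \<and>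
      u \<inter> (m - {Max m}) = {} \<and> u \<union> (m - {Max m}) \<notin> L" for u m
    unfolding U_def L_def by (auto simp: ext_monomial_mult_in_ideal_iff[OF ideal])
  show ?thesis
  proof (intro equalityI subsetI)
    fix T assume T: "T \<in> critical L"
    then obtain m where m: "m \<in> M" "m \<subseteq> T" by (auto simp: critical_def L)
    then have "m \<in> L" using L by blast
    then have "m \<noteq> {}" using deg by fastforce
    have "x \<in> m" if "T - {x} \<notin> L" for x
      using that m unfolding L by blast
    then have "Min T \<in> m" "Max T \<in> m" using T by (auto simp: critical_def)
    then have ends: "Min m = Min T" "Max m = Max T"
      using m(2) \<open>m \<noteq> {}\<close> by (auto intro!: Min_eqI Max_eqI)
    have "x \<in> {Min m<..<Max m}" if "x \<in> T - m" for x
      using that \<open>Min T \<in> m\<close> \<open>Max T \<in> m\<close> unfolding ends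
      by (metis Diff_iff Max_ge Min_le finite greaterThanLessThan_iff less_le)
    moreover have "(T - m) \<union> (m - {x}) = T - {x}" if "x \<in> m" for x
      using m(2) that by blast
    ultimately have "T - m \<in> U inI m"
      using T \<open>Min T \<in> m\<close> \<open>Max T \<in> m\<close> unfolding U by (auto simp: ends critical_def)
    moreover have "T = (T - m) \<union> m" using m(2) by blast
    ultimately show "T \<in> {u \<union> m | u m. m \<in> M \<and> u \<in> U inI m}" using m(1) by blast
  next
    fix T assume "T \<in> {u \<union> m | u m. m \<in> M \<and> u \<in> U inI m}"
    then obtain u m where m: "m \<in> M" and u: "u \<in> U inI m" and T: "T = u \<union> m" by blast
    from m have "m \<in> L" using L by blast
    then have "m \<noteq> {}" using deg by fastforce
    have u': "u \<subseteq> {Min m<..<Max m}" using u by (simp add: U)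
    then have "T - {Min T} = u \<union> (m - {Min m})" "T - {Max T} = u \<union> (m - {Max m})"
      unfolding T Min_Max_between[OF \<open>m \<noteq> {}\<close> u'] by auto
    moreover have "T \<in> L" using m T L by blast
    ultimately show "T \<in> critical L" using u by (auto simp: critical_def U)
  qed
qed

section \<open>Minimal generators and Groebner bases\<close>

lemma word_antichain_minimal:
  assumes antichain: "\<And>v w a b. v \<in> W \<Longrightarrow> w \<in> W \<Longrightarrow> w = a @ v @ b \<Longrightarrow> v = w"
    and "W' \<subseteq> W"
    and "ideal_gen (word ` W') = (ideal_gen (word ` W) :: ('v, 'k::field) free_algebra set)"
  shows "W' = W"
proof (rule equalityI[OF assms(2)], rule subsetI)
  fix w assume "w \<in> W"
  then have "word w \<in> (ideal_gen (word ` W') :: ('v, 'k) free_algebra set)"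
    unfolding assms(3) using ideal_gen_superset by blast
  then obtain a v b where "v \<in> W'" "w = a @ v @ b" by (auto simp: word_in_ideal_gen_iff)
  with antichain[of v w a b] \<open>w \<in> W\<close> assms(2) show "w \<in> W'" by blast
qed

text \<open>
  A generating set of least cardinality is a minimal one, and it consists of minimal generators by
  definition.
\<close>

lemma minimal_generators_generate:
  fixes mon :: "'m::finite \<Rightarrow> 'a::ring_1"
  assumes "L = ideal_gen (mon ` M)"
  shows "ideal_gen (mon ` minimal_generators mon L) = L"
proof (rule equalityI)
  have "mon m \<in> L" if m: "m \<in> minimal_generators mon L" for m
  proof -
    obtain N where "m \<in> N" "ideal_gen (mon ` N) = L"
      using m unfolding minimal_generators_def minimally_generates_def by blast
    then show ?thesis using ideal_gen_superset[of "mon ` N"] by blast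
  qed
  then show "ideal_gen (mon ` minimal_generators mon L) \<subseteq> L"
    unfolding assms by (intro ideal_gen_least is_ideal_ideal_gen) blast
next
  let ?gen = "\<lambda>M. ideal_gen (mon ` M) = L"
  obtain N where N: "?gen N" "\<And>N'. ?gen N' \<Longrightarrow> card N \<le> card N'"
    using ex_has_least_nat[of ?gen M card] assms by blast
  then have "minimally_generates mon N L"
    unfolding minimally_generates_def by (meson finite leD psubset_card_mono)
  then have "N \<subseteq> minimal_generators mon L" unfolding minimal_generators_def by blast
  then show "L \<subseteq> ideal_gen (mon ` minimal_generators mon L)"
    using N(1) ideal_gen_mono image_mono by metis
qed

lemma initials_eq_image:
  assumes "\<And>a b. lt a b \<Longrightarrow> \<not> lt b a" "\<And>f. f \<in> F \<Longrightarrow> \<exists>m. is_initial supp lt f m"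
  shows "initials supp lt F = initial supp lt ` F"
proof -
  have "initial supp lt f = m" if "is_initial supp lt f m" for f m
    using assms(1) that by (rule initial_eqI)
  then have "is_initial supp lt f m \<longleftrightarrow> m = initial supp lt f" if "f \<in> F" for f m
    using assms(2)[OF that] by metis
  then show ?thesis by (auto simp: initials_def)
qed

text \<open>
  An element without an initial monomial could be dropped from the basis.
\<close>

lemma minimal_groebner_basis_has_initial:
  assumes "minimal_groebner_basis mon supp lt I G" "f \<in> G"
  shows "\<exists>m. is_initial supp lt f m"
proof (rule ccontr)
  assume "\<nexists>m. is_initial supp lt f m"
  then have "initials supp lt (G - {f}) = initials supp lt G" by (auto simp: initials_def)
  with assms have "groebner_basis mon supp lt I (G - {f})"
    by (auto simp: minimal_groebner_basis_def groebner_basis_def)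
  moreover have "G - {f} \<subset> G" using assms(2) by blast
  ultimately show False using assms(1) unfolding minimal_groebner_basis_def by blast
qed

lemma homogeneous_ideal_degree:
  fixes F :: "('v::{finite,linorder}, 'k::field) ext set"
  assumes "\<forall>f\<in>F. \<exists>d\<ge>2. ext_homogeneous d f" "e \<in> ideal_gen F" "S \<in> ext_keys e"
  shows "2 \<le> card S"
proof -
  let ?N = "{e :: ('v, 'k) ext. \<forall>S\<in>ext_keys e. 2 \<le> card S}"
  have "is_ideal ?N"
    by (rule ext_keys_ideal) (meson card_mono finite le_trans)
  moreover have "F \<subseteq> ?N" using assms(1) by (fastforce simp: ext_homogeneous_def)
  ultimately show ?thesis using ideal_gen_least assms(2,3) by blast
qed

lemma abs_ext_anticommutator:
  assumes "f \<in> anticommutators" shows "abs_ext f = 0"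
proof -
  have "f \<in> anticommutator_ideal"
    unfolding anticommutator_ideal_def using assms ideal_gen_superset by blast
  then have "abs_ext f = abs_ext 0" by (simp add: ext.abs_eq_iff)
  then show ?thesis by (simp add: abs_ext_zero)
qed

theorem theorem2p1:
  fixes I :: "('v::{finite,linorder}, 'k::field) ext set"
    and J :: "('v, 'k) free_algebra set"
    and lt_s :: "'v multiset \<Rightarrow> 'v multiset \<Rightarrow> bool"
    and lt_e :: "'v set \<Rightarrow> 'v set \<Rightarrow> bool"
    and lt_t :: "'v list \<Rightarrow> 'v list \<Rightarrow> bool"
    and G :: "('v, 'k) ext set"
    and inI :: "('v, 'k) ext set"
    and B :: "('v, 'k) free_algebra set"
  assumes "infinite (UNIV :: 'k set)"
    and "monoid_well_order lt_s"
    and "lt_e = order_e lt_s"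
    and "is_order_t TYPE('k) lt_s lt_t"
    and "\<exists>F. I = ideal_gen F \<and> (\<forall>f\<in>F. \<exists>d\<ge>2. ext_homogeneous d f)"
    and "J = abs_ext -` I"
    and "minimal_groebner_basis ext_monomial ext_keys lt_e I G"
    and "inI = initial_ideal ext_monomial ext_keys lt_e I"
    and "B = anticommutators \<union>
             {delta (ext_monomial u * f) | u f. f \<in> G \<and> u \<in> U inI (initial ext_keys lt_e f)}"
  shows "groebner_basis word Poly_Mapping.keys lt_t J B \<and>
    (\<forall>B'. one_per_initial Poly_Mapping.keys lt_t B B' \<longrightarrow>
       minimal_groebner_basis word Poly_Mapping.keys lt_t J B') \<and>
    minimally_generates word
      ({[i, j] | i j. j \<le> i} \<union>
       {increasing_word (u \<union> m) | u m. m \<in> minimal_generators ext_monomial inI \<and> u \<in> U inI m})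
      (initial_ideal word Poly_Mapping.keys lt_t J)"
proof -
  note order_s = assms(2) and lt_e = assms(3) and order_t = assms(4)
  define L where "L = {S. ext_monomial S \<in> inI}"
  obtain F where F: "I = ideal_gen F" "\<forall>f\<in>F. \<exists>d\<ge>2. ext_homogeneous d f" using assms(5) by blast
  have ideal_I: "is_ideal I" unfolding F(1) by (rule is_ideal_ideal_gen)
  have deg: "2 \<le> card S" if S: "S \<in> L" for S
  proof -
    obtain m where "m \<in> initials ext_keys lt_e I" "m \<subseteq> S"
      using S unfolding L_def assms(8) initial_ideal_def
      by (auto simp: ext_monomial_in_ideal_gen_iff)
    then have "2 \<le> card m"
      using homogeneous_ideal_degree[OF F(2)] by (auto simp: F(1) initials_def is_initial_def)
    with \<open>m \<subseteq> S\<close> show ?thesis by (meson card_mono finite le_trans)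
  qed
  have up: "T \<in> L" if "S \<in> L" "S \<subseteq> T" for S T
    using that unfolding L_def assms(8) initial_ideal_def
    by (auto simp: ext_monomial_in_ideal_gen_iff)
  have asym_t: "\<not> lt_t w v" if "lt_t v w" for v w
    by (rule is_order_t_asym[OF order_s order_t that])
  have asym_e: "\<not> lt_e T S" if "lt_e S T" for S T
    using that order_e_properties(2)[OF order_s] unfolding lt_e by blast
  have initial_G: "is_initial ext_keys lt_e f (initial ext_keys lt_e f)" if "f \<in> G" for f
    using minimal_groebner_basis_has_initial[OF assms(7) that] initial_eqI[of lt_e, OF asym_e]
    by metis
  have G: "G \<subseteq> I" "inI = ideal_gen (ext_monomial ` initials ext_keys lt_e G)"
    using assms(7,8) by (simp_all add: minimal_groebner_basis_def groebner_basis_def)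
  have "initials ext_keys lt_e G = initial ext_keys lt_e ` G"
    using asym_e initial_G by (intro initials_eq_image) blast+
  with G(2) have inI: "inI = ideal_gen (ext_monomial ` initial ext_keys lt_e ` G)" by simp
  have ideal_inI: "is_ideal inI" unfolding inI by (rule is_ideal_ideal_gen)
  have critical_U: "critical L = {u \<union> m | u m. m \<in> M \<and> u \<in> U inI m}"
    if "inI = ideal_gen (ext_monomial ` M)" for M
    using critical_eq_U[OF that] deg by (simp add: L_def)
  have antichain: "v = w" if "v \<in> obstructions L" "w \<in> obstructions L" "w = a @ v @ b" for v w a b
    by (rule obstructions_antichain[OF up deg that])
  \<comment> \<open>By the antichain property, no obstruction can be dropped; this yields the minimality of the
    Groebner bases and of the generators alike.\<close>
  have minimal: "W = obstructions L" if "W \<subseteq> obstructions L"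
    "ideal_gen (word ` W) = (ideal_gen (word ` obstructions L) :: ('v, 'k) free_algebra set)" for W
    by (rule word_antichain_minimal[OF antichain that])

  have initial_anti: "is_initial Poly_Mapping.keys lt_t
      (anticommutator i j :: ('v, 'k) free_algebra) [i, j]"
    if "j \<le> i" for i j
    by (rule initial_anticommutator[OF order_t that])
  have initial_lift: "is_initial Poly_Mapping.keys lt_t (delta (ext_monomial u * f))
      (increasing_word (u \<union> initial ext_keys lt_e f))"
    if "f \<in> G" "u \<in> U inI (initial ext_keys lt_e f)" for u f
  proof -
    have "ext_monomial (initial ext_keys lt_e f) \<in> inI"
      unfolding inI using that(1) by (intro subsetD[OF ideal_gen_superset] imageI)
    then have "initial ext_keys lt_e f \<in> L" by (simp add: L_def)
    then have "initial ext_keys lt_e f \<noteq> {}" using deg by fastforce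
    then have "u \<inter> initial ext_keys lt_e f = {}" using U_disjoint[OF ideal_inI _ that(2)] by blast
    with initial_G[OF that(1)] show ?thesis
      unfolding lt_e by (intro initial_delta[OF order_t] initial_monomial_mult[OF order_s])
  qed
  have initial_B: "is_initial Poly_Mapping.keys lt_t b (initial Poly_Mapping.keys lt_t b)"
    if "b \<in> B" for b
  proof -
    have "\<exists>w. is_initial Poly_Mapping.keys lt_t b w"
      using that initial_anti initial_lift unfolding assms(9) anticommutators_def by blast
    then show ?thesis using initial_eqI[of lt_t, OF asym_t] by metis
  qed
  have image_initial: "initials Poly_Mapping.keys lt_t B' = initial Poly_Mapping.keys lt_t ` B'"
    if "B' \<subseteq> B" for B'
    using asym_t initial_B that by (intro initials_eq_image) blast+
  have "initials Poly_Mapping.keys lt_t B = descents \<union>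
      {increasing_word (u \<union> initial ext_keys lt_e f) | u f.
        f \<in> G \<and> u \<in> U inI (initial ext_keys lt_e f)}"
  proof (intro equalityI subsetI)
    fix w assume "w \<in> initials Poly_Mapping.keys lt_t B"
    then obtain b where b: "b \<in> B" "is_initial Poly_Mapping.keys lt_t b w"
      by (auto simp: initials_def)
    then have w: "w = v" if "is_initial Poly_Mapping.keys lt_t b v" for v
      using that initial_eqI[of lt_t, OF asym_t] by metis
    from b(1) consider i j where "j \<le> i" "b = anticommutator i j"
      | u f where "f \<in> G" "u \<in> U inI (initial ext_keys lt_e f)" "b = delta (ext_monomial u * f)"
      unfolding assms(9) anticommutators_def by blast
    then show "w \<in> descents \<union> {increasing_word (u \<union> initial ext_keys lt_e f) | u f.
        f \<in> G \<and> u \<in> U inI (initial ext_keys lt_e f)}"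
    proof cases
      case 1
      with w initial_anti have "w = [i, j]" by blast
      with 1 show ?thesis by (auto simp: descents_def)
    next
      case 2
      with w initial_lift have "w = increasing_word (u \<union> initial ext_keys lt_e f)" by blast
      with 2 show ?thesis by blast
    qed
  next
    fix w assume "w \<in> descents \<union> {increasing_word (u \<union> initial ext_keys lt_e f) | u f.
        f \<in> G \<and> u \<in> U inI (initial ext_keys lt_e f)}"
    then consider i j where "j \<le> i" "w = [i, j]"
      | u f where "f \<in> G" "u \<in> U inI (initial ext_keys lt_e f)"
          "w = increasing_word (u \<union> initial ext_keys lt_e f)"
      unfolding descents_def by blast
    then show "w \<in> initials Poly_Mapping.keys lt_t B"
    proof cases
      case 1
      moreover have "anticommutator i j \<in> B" using 1 by (auto simp: assms(9) anticommutators_def)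
      ultimately show ?thesis using initial_anti[of j i] unfolding initials_def by blast
    next
      case 2
      moreover have "delta (ext_monomial u * f) \<in> B" using 2 by (auto simp: assms(9))
      ultimately show ?thesis using initial_lift[of f u] unfolding initials_def by blast
    qed
  qed
  also have "\<dots> = obstructions L"
    unfolding obstructions_def critical_U[OF inI] by blast
  finally have initials_B: "initials Poly_Mapping.keys lt_t B = obstructions L" .

  have "B \<subseteq> J"
  proof
    fix b assume "b \<in> B"
    then consider "b \<in> anticommutators" | u f where "f \<in> G" "b = delta (ext_monomial u * f)"
      unfolding assms(9) by blast
    then show "b \<in> J"
    proof cases
      case 1
      then show ?thesis
        using ideal_I unfolding assms(6) by (simp add: abs_ext_anticommutator is_ideal_def)
    next
      case 2
      then have "ext_monomial u * f \<in> I" using G(1) ideal_I by (blast intro: ideal_mult_left)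
      with 2 show ?thesis by (simp add: assms(6) abs_ext_delta)
    qed
  qed
  \<comment> \<open>The essential inclusion: initial words of $J$ contain an obstruction, either a descent or, if they
    are increasing, the critical piece of a word whose letters form an initial monomial of $I$.\<close>
  have "word w \<in> (ideal_gen (word ` obstructions L) :: ('v, 'k) free_algebra set)"
    if "w \<in> initials Poly_Mapping.keys lt_t J" for w
  proof -
    obtain f where f: "abs_ext f \<in> I" "is_initial Poly_Mapping.keys lt_t f w"
      using \<open>w \<in> _\<close> unfolding initials_def assms(6) by blast
    have "set w \<in> L" if "sorted_wrt (<) w"
    proof -
      have "set w \<in> initials ext_keys lt_e I"
        using initial_quotient[OF order_s order_t f(2) that] f(1) unfolding initials_def lt_e by blast
      then have "ext_monomial (set w) \<in> inI"
        unfolding assms(8) initial_ideal_def by (intro subsetD[OF ideal_gen_superset] imageI)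
      then show ?thesis by (simp add: L_def)
    qed
    moreover have "{} \<notin> L" using deg by fastforce
    ultimately show ?thesis using obstruction_factor[of L w] by (simp add: word_in_ideal_gen_iff)
  qed
  then have "initial_ideal word Poly_Mapping.keys lt_t J \<subseteq> ideal_gen (word ` obstructions L)"
    unfolding initial_ideal_def by (intro ideal_gen_least is_ideal_ideal_gen) blast
  moreover have "ideal_gen (word ` obstructions L) \<subseteq> initial_ideal word Poly_Mapping.keys lt_t J"
    unfolding initial_ideal_def initials_B[symmetric] using \<open>B \<subseteq> J\<close>
    by (intro ideal_gen_mono image_mono) (auto simp: initials_def)
  ultimately have inJ: "initial_ideal word Poly_Mapping.keys lt_t J = ideal_gen (word ` obstructions L)"
    by blast

  have "minimal_groebner_basis word Poly_Mapping.keys lt_t J B'"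
    if "one_per_initial Poly_Mapping.keys lt_t B B'" for B'
  proof -
    have B': "B' \<subseteq> B" and inj: "inj_on (initial Poly_Mapping.keys lt_t) B'"
      and img: "initial Poly_Mapping.keys lt_t ` B' = initial Poly_Mapping.keys lt_t ` B"
      using that by (auto simp: one_per_initial_def bij_betw_def)
    then have img': "initial Poly_Mapping.keys lt_t ` B' = obstructions L"
      using initials_B image_initial[of B] by simp
    have "\<not> groebner_basis word Poly_Mapping.keys lt_t J B''" if "B'' \<subset> B'" for B''
    proof
      assume "groebner_basis word Poly_Mapping.keys lt_t J B''"
      then have "ideal_gen (word ` initial Poly_Mapping.keys lt_t ` B'') =
          (ideal_gen (word ` obstructions L) :: ('v, 'k) free_algebra set)"
        using image_initial[of B''] that B' by (simp add: groebner_basis_def inJ)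
      moreover have "initial Poly_Mapping.keys lt_t ` B'' \<subseteq> obstructions L"
        using that img' by blast
      ultimately have "initial Poly_Mapping.keys lt_t ` B'' = obstructions L"
        by (metis minimal)
      then have "B'' = B'" using inj_on_image_eq_iff[OF inj, of B'' B'] img' that by blast
      with that show False by blast
    qed
    moreover have "groebner_basis word Poly_Mapping.keys lt_t J B'"
      using B' \<open>B \<subseteq> J\<close> image_initial[OF B'] img' by (auto simp: groebner_basis_def inJ)
    ultimately show ?thesis by (simp add: minimal_groebner_basis_def)
  qed
  moreover have "groebner_basis word Poly_Mapping.keys lt_t J B"
    using \<open>B \<subseteq> J\<close> by (simp add: groebner_basis_def initials_B inJ)
  moreover have "{[i, j] | i j. j \<le> i} \<union> {increasing_word (u \<union> m) | u m.
      m \<in> minimal_generators ext_monomial inI \<and> u \<in> U inI m} = obstructions L"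
    unfolding obstructions_def descents_def
      critical_U[OF minimal_generators_generate[OF inI, symmetric]] image_Collect
    by (rule arg_cong[where f = "\<lambda>A. _ \<union> A"]) blast
  moreover have "minimally_generates word (obstructions L) (initial_ideal word Poly_Mapping.keys lt_t J)"
    unfolding minimally_generates_def inJ using minimal by blast
  ultimately show ?thesis by simp
qed

end
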